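(* Let one of the following two cases hold. (Continuous case) $\psi_\theta(x)=e^{-\frac14(x-A\theta)^\top\Sigma^{-1}(x-A\theta)}$ for $x\in\mathbb{R}^{3N}$, $\theta\in\mathbb{R}^{N_p}$, where $\Sigma\in\mathbb{R}^{3N\times3N}$ is symmetric positive definite and $A\in\mathbb{R}^{3N\times N_p}$ satisfies $0<\operatorname{rank}(A)<N_p$; and, writing $x=(x_1,\dots,x_N)$ with $x_i\in\mathbb{R}^3$, $\mathscr{H}$ is the electronic Hamiltonian $$\mathscr{H}=-\frac12\sum_{i=1}^N\Delta_{x_i}-\sum_{i=1}^N\sum_{I=1}^M\frac{Z_I}{\|x_i-R_I\|}+\sum_{1\le i<j\le N}\frac1{\|x_i-x_j\|}+\sum_{1\le I<I'\le M}\frac{Z_IZ_{I'}}{\|R_I-R_{I'}\|},$$ with (distinct) nuclear positions $R_I\in\mathbb{R}^3$ and nuclear charges $Z_I\in\mathbb{N}$. (Discrete case) $\psi_\theta(x)=2^{-N/2}e^{\mathrm{i}\,x^\top A\theta}$ for $x\in\{-1,1\}^N$, $\theta\in\mathbb{R}^{N_p}$, where $A\in\mathbb{R}^{N\times N_p}$ satisfies $0<\operatorname{rank}(A)<N_p$; and $\mathscr{H}$ is a spin-lattice Hamiltonian on $\{-1,1\}^N$. Let $\lambda>0$, $0\le\mu<1$, and let the step sizes satisfy $0<\eta_k\le\eta_{k-1}$ for $k\ge1$ and $0<\eta_0\le\frac{2\lambda(1-\mu)}{C_g}$, where $C_g>0$ is a Lipschitz constant of $g$. Let $\{\theta_k\}_{k\ge0}$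 be generated, from given $\theta_0,\Delta\theta_{-1}\in\mathbb{R}^{N_p}$, by $$\Delta\theta_k=(\lambda I+S(\theta_k))^{-1}\Big(\lambda\mu\,\Delta\theta_{k-1}-\tfrac12 g(\theta_k)\Big),\qquad \theta_{k+1}=\theta_k+\eta_k\Delta\theta_k,\qquad k\ge0.$$ Then there exists $C>0$ such that for every $K\ge1$, $$\sum_{k=1}^K\eta_k\|g(\theta_k)\|^2\le C.$$
   Context: The energy is $L(\theta)=\langle\psi_\theta|\mathscr{H}|\psi_\theta\rangle/\langle\psi_\theta|\psi_\theta\rangle$ (with $L^2(\mathbb{R}^{3N})$ inner product in the continuous case, and $\ell^2$ inner product over $\{-1,1\}^N$ in the discrete case), and $g(\theta)=\nabla_\theta L(\theta)$. The probability distribution is $\pi_\theta\propto|\psi_\theta|^2$. The SR matrix is $S(\theta)=\mathrm{Re}\,\mathbb{E}_{X\sim\pi_\theta}[O(\theta;X)O(\theta;X)^*]$, where $O(\theta;x)=\nabla_\theta\log\psi_\theta(x)-\mathbb{E}_{X\sim\pi_\theta}[\nabla_\theta\log\psi_\theta(X)]$, $\nabla_\theta\log\psi_\theta(x):=\nabla_\theta\psi_\theta(x)/\psi_\theta(x)$, and $^*$ is the conjugate transpose (for real wavefunctions this is just $\mathbb{E}[OO^\top]$). In these examples $S(\theta)=\frac14A^\top\Sigma^{-1}A$ (continuous case) and $S(\theta)=A^\top A$ (discrete case), independent of $\theta$. A spin-lattice Hamiltonian is a self-adjoint matrix $\mathscr{H}\in\mathbb{C}^{2^N\times2^N}$ with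 entries $\langle x|\mathscr{H}|y\rangle$, $x,y\in\{-1,1\}^N$ (for example the transverse-field Ising model $-\sum_{\langle i,j\rangle}\sigma_i^z\sigma_j^z-h\sum_j\sigma_j^x$ or the Heisenberg model $\sum_{\langle i,j\rangle}(\sigma_i^x\sigma_j^x+\sigma_i^y\sigma_j^y+\sigma_i^z\sigma_j^z)$, with $\sigma_i^{x,y,z}$ the Pauli matrices acting on site $i$ and $\langle i,j\rangle$ nearest-neighbor pairs). $\mathrm{i}$ is the imaginary unit and $\|\cdot\|$ the Euclidean norm. In the algorithm of interest $\Delta\theta_{-1}=0$. *)

theory Defs
  imports "HOL-Analysis.Analysis"
begin

text \<open>
  Wavefunctions are complex-valued functions on \<^typ>\<open>real^'d\<close>. A reference measure
  \<open>\<nu>\<close> fixes the Hilbert space: Lebesgue measure for \<open>L\<^sup>2\<close>, counting measure on the spin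
  configurations for \<open>\<ell>\<^sup>2\<close>. A Hamiltonian is an operator on wavefunctions, and a
  parametrized wavefunction is a function \<open>\<psi> \<theta> x\<close>.
\<close>

definition partial_deriv :: "'d \<Rightarrow> (real^'d \<Rightarrow> 'b::real_normed_vector) \<Rightarrow> real^'d \<Rightarrow> 'b"
  where "partial_deriv j f x = vector_derivative (\<lambda>t. f (x + t *\<^sub>R axis j 1)) (at 0)"

definition grad :: "(real^'d \<Rightarrow> 'b::real_normed_vector) \<Rightarrow> real^'d \<Rightarrow> 'b^'d"
  where "grad f x = (\<chi> j. partial_deriv j f x)"

definition braket :: "'x measure \<Rightarrow> ('x \<Rightarrow> complex) \<Rightarrow> ('x \<Rightarrow> complex) \<Rightarrow> complex"
  where "braket \<nu> f h = (\<integral>x. cnj (f x) * h x \<partial>\<nu>)"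

text \<open>The Rayleigh quotient is real for a self-adjoint Hamiltonian; \<^const>\<open>Re\<close> only
  converts it to type \<^typ>\<open>real\<close>.\<close>

definition energy ::
  "'x measure \<Rightarrow> (('x \<Rightarrow> complex) \<Rightarrow> 'x \<Rightarrow> complex) \<Rightarrow> (real^'p \<Rightarrow> 'x \<Rightarrow> complex) \<Rightarrow> real^'p \<Rightarrow> real"
  where "energy \<nu> H \<psi> \<theta> = Re (braket \<nu> (\<psi> \<theta>) (H (\<psi> \<theta>)) / braket \<nu> (\<psi> \<theta>) (\<psi> \<theta>))"

definition born_measure :: "'x measure \<Rightarrow> ('x \<Rightarrow> complex) \<Rightarrow> 'x measure"
  where "born_measure \<nu> f =
    density \<nu> (\<lambda>x. ennreal ((cmod (f x))\<^sup>2 / (\<integral>y. (cmod (f y))\<^sup>2 \<partial>\<nu>)))"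

definition grad_log :: "(real^'p \<Rightarrow> 'x \<Rightarrow> complex) \<Rightarrow> real^'p \<Rightarrow> 'x \<Rightarrow> complex^'p"
  where "grad_log \<psi> \<theta> x = (\<chi> j. grad (\<lambda>\<theta>'. \<psi> \<theta>' x) \<theta> $ j / \<psi> \<theta> x)"

definition centered_grad_log ::
  "'x measure \<Rightarrow> (real^'p \<Rightarrow> 'x \<Rightarrow> complex) \<Rightarrow> real^'p \<Rightarrow> 'x \<Rightarrow> complex^'p"
  where "centered_grad_log \<nu> \<psi> \<theta> x =
    grad_log \<psi> \<theta> x - (\<integral>y. grad_log \<psi> \<theta> y \<partial>born_measure \<nu> (\<psi> \<theta>))"

definition SR_matrix :: "'x measure \<Rightarrow> (real^'p \<Rightarrow> 'x \<Rightarrow> complex) \<Rightarrow> real^'p \<Rightarrow> real^'p^'p"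
  where "SR_matrix \<nu> \<psi> \<theta> =
    (\<chi> j k. Re (\<integral>x. centered_grad_log \<nu> \<psi> \<theta> x $ j * cnj (centered_grad_log \<nu> \<psi> \<theta> x $ k)
                  \<partial>born_measure \<nu> (\<psi> \<theta>)))"


section \<open>Continuous case\<close>

text \<open>\<open>\<real>\<^bsup>3N\<^esup>\<close> is \<^typ>\<open>real^('n \<times> 3)\<close>: coordinate \<open>(i, c)\<close> is the \<open>c\<close>-th component of the position
  of electron \<open>i\<close>. The linear order on \<^typ>\<open>'n\<close> is used only to enumerate pairs of electrons.\<close>

definition electron_pos :: "real^('n::finite \<times> 3) \<Rightarrow> 'n \<Rightarrow> real^3"
  where "electron_pos x i = (\<chi> c. x $ (i, c))"

definition laplacian_at :: "'n::finite \<Rightarrow> (real^('n \<times> 3) \<Rightarrow> complex) \<Rightarrow> real^('n \<times> 3) \<Rightarrow> complex"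
  where "laplacian_at i f x = (\<Sum>c\<in>UNIV. partial_deriv (i, c) (partial_deriv (i, c) f) x)"

text \<open>Division by zero on the null set of Coulomb singularities gives 0, which does not
  affect any integral.\<close>

definition coulomb_potential ::
  "nat \<Rightarrow> (nat \<Rightarrow> nat) \<Rightarrow> (nat \<Rightarrow> real^3) \<Rightarrow> real^('n::{finite,linorder} \<times> 3) \<Rightarrow> real"
  where "coulomb_potential M Z R x =
    - (\<Sum>i\<in>UNIV. \<Sum>I=1..M. real (Z I) / norm (electron_pos x i - R I))
    + (\<Sum>(i, j)\<in>{(i, j). i < j}. 1 / norm (electron_pos x i - electron_pos x j))
    + (\<Sum>I=1..M. \<Sum>I'\<in>{I<..M}. real (Z I) * real (Z I') / norm (R I - R I'))"

definition electronic_hamiltonian ::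
  "nat \<Rightarrow> (nat \<Rightarrow> nat) \<Rightarrow> (nat \<Rightarrow> real^3)
    \<Rightarrow> (real^('n::{finite,linorder} \<times> 3) \<Rightarrow> complex) \<Rightarrow> real^('n \<times> 3) \<Rightarrow> complex"
  where "electronic_hamiltonian M Z R f x =
    - (1/2) * (\<Sum>i\<in>UNIV. laplacian_at i f x) + of_real (coulomb_potential M Z R x) * f x"

definition symmetric_pos_def :: "real^'d^'d \<Rightarrow> bool"
  where "symmetric_pos_def \<Sigma> \<longleftrightarrow>
    transpose \<Sigma> = \<Sigma> \<and> (\<forall>x. x \<noteq> 0 \<longrightarrow> 0 < x \<bullet> (\<Sigma> *v x))"

definition gaussian_wf :: "real^'d^'d \<Rightarrow> real^'p^'d \<Rightarrow> real^'p \<Rightarrow> real^'d \<Rightarrow> complex"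
  where "gaussian_wf \<Sigma> A \<theta> x =
    of_real (exp (- (1/4) * ((x - A *v \<theta>) \<bullet> (matrix_inv \<Sigma> *v (x - A *v \<theta>)))))"


section \<open>Discrete case\<close>

definition spin_configs :: "(real^'n) set"
  where "spin_configs = {x. \<forall>i. x $ i \<in> {-1, 1}}"

text \<open>A matrix indexed by spin configurations is a function \<open>h x y\<close>, of which only the values
  on \<^const>\<open>spin_configs\<close> matter.\<close>

definition self_adjoint_spin_matrix :: "(real^'n \<Rightarrow> real^'n \<Rightarrow> complex) \<Rightarrow> bool"
  where "self_adjoint_spin_matrix h \<longleftrightarrow>
    (\<forall>x\<in>spin_configs. \<forall>y\<in>spin_configs. h x y = cnj (h y x))"

definition spin_hamiltonian ::
  "(real^'n \<Rightarrow> real^'n \<Rightarrow> complex) \<Rightarrow> (real^'n \<Rightarrow> complex) \<Rightarrow> real^'n \<Rightarrow> complex"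
  where "spin_hamiltonian h f x = (\<Sum>y\<in>spin_configs. h x y * f y)"

definition phase_wf :: "real^'p^'n \<Rightarrow> real^'p \<Rightarrow> real^'n \<Rightarrow> complex"
  where "phase_wf A \<theta> x =
    of_real (2 powr (- real CARD('n) / 2)) * exp (\<i> * of_real (x \<bullet> (A *v \<theta>)))"

end

theory Submission
  imports Defs "HOL-Probability.Distributions"
begin

text \<open>Only three features of the two models matter: the energy is bounded below, it is
  differentiable with gradient \<open>g\<close>, and the SR matrix is a constant positive semidefinite
  matrix. Multiplying the update by \<open>lam I + S\<close> expresses \<open>g\<close> through two consecutive momenta, so
  the descent lemma turns \<open>L + weight * \<eta> * (norm \<Delta>\<theta>)\<^sup>2\<close> into a Lyapunov function.
  In the discrete case everything is a finite sum. In the continuous case translation invariance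
  makes \<open>S\<close> and the kinetic energy constant and reduces the energy to the convolution of the
  Coulomb potential with a Gaussian; its regularity only needs the integrals of the potential
  against Gaussians to be bounded uniformly in their centre.\<close>

section \<open>Gradient descent with momentum\<close>

text \<open>\<open>grad\<close> and \<open>matrix_inv\<close> rest on a choice operator, so both
  carry information only once differentiability and invertibility are proved. Differentiability is
  needed along lines only, with a derivative that is linear in the direction, because the descent
  inequality never looks beyond a segment. The obstacle in the continuous case is the Coulomb
  potential, which may be unbounded in both signs and has singularities: every derivative in the
  parameter is therefore put on the Gaussian. Every estimate must hold for all centres of the
  Gaussian at once, because nothing confines the iterates to a bounded set. Crude constants suffice,
  so normalisations and means stay unevaluated.\<close>

lemma descent_lemma:
  fixes L :: "'a::real_inner \<Rightarrow> real" and g :: "'a \<Rightarrow> 'a"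
  assumes deriv: "\<And>x v. ((\<lambda>t. L (x + t *\<^sub>R v)) has_real_derivative g x \<bullet> v) (at 0)"
    and lip: "C-lipschitz_on UNIV g"
  shows "L (x + v) \<le> L x + g x \<bullet> v + C / 2 * (norm v)\<^sup>2"
proof -
  \<comment> \<open>Up to the constant \<open>L x\<close>, the gap between the quadratic model and
    \<open>L\<close> on the segment. The Lipschitz bound makes its derivative nonnegative for
    \<open>t \<ge> 0\<close>, so monotonicity of \<open>f\<close> replaces integrating
    \<open>g\<close> along the segment.\<close>
  define f where "f t = t * (g x \<bullet> v) + C * t\<^sup>2 / 2 * (norm v)\<^sup>2 - L (x + t *\<^sub>R v)" for t
  have d: "((\<lambda>t. L (x + t *\<^sub>R v)) has_real_derivative g (x + t *\<^sub>R v) \<bullet> v) (at t)" for t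
    using deriv[of "x + t *\<^sub>R v" v] DERIV_shift[of "\<lambda>s. L (x + s *\<^sub>R v)" "g (x + t *\<^sub>R v) \<bullet> v" 0 t]
    by (simp add: algebra_simps)
  have df: "(f has_real_derivative g x \<bullet> v + C * t * (norm v)\<^sup>2 - g (x + t *\<^sub>R v) \<bullet> v) (at t)" for t
    unfolding f_def by (rule derivative_eq_intros d refl | simp)+
  have nonneg: "0 \<le> g x \<bullet> v + C * t * (norm v)\<^sup>2 - g (x + t *\<^sub>R v) \<bullet> v" if "0 \<le> t" for t
  proof -
    have "(g (x + t *\<^sub>R v) - g x) \<bullet> v \<le> norm (g (x + t *\<^sub>R v) - g x) * norm v"
      by (rule norm_cauchy_schwarz)
    also have "\<dots> \<le> (C * norm (t *\<^sub>R v)) * norm v"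
      using lipschitz_onD[OF lip, of "x + t *\<^sub>R v" x] by (intro mult_right_mono) (auto simp: dist_norm)
    finally show ?thesis using that by (simp add: inner_diff_left power2_eq_square mult_ac)
  qed
  have "f 0 \<le> f 1"
    by (rule DERIV_nonneg_imp_nondecreasing[of 0 1 f]) (use df nonneg in \<open>auto intro!: exI\<close>)
  then show ?thesis by (simp add: f_def)
qed

text \<open>Partial derivatives alone say nothing about other directions. If all directional
  derivatives exist and are linear in the direction, expanding \<open>v\<close> in the coordinate
  basis recovers them from the partial ones.\<close>

lemma grad_eqI:
  fixes L :: "real^'p \<Rightarrow> real"
  assumes deriv: "\<And>v. ((\<lambda>t. L (x + t *\<^sub>R v)) has_real_derivative d v) (at 0)" and lin: "linear d"
  shows "grad L x \<bullet> v = d v"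
proof -
  have "partial_deriv j L x = d (axis j 1)" for j
    unfolding partial_deriv_def
    using deriv[of "axis j 1"]
    by (intro vector_derivative_at) (simp add: has_real_derivative_iff_has_vector_derivative)
  then have "grad L x \<bullet> v = (\<Sum>j\<in>UNIV. d (axis j 1) * v $ j)"
    by (simp add: grad_def inner_vec_def)
  also have "\<dots> = d (\<Sum>j\<in>UNIV. v $ j *\<^sub>R axis j 1)"
    by (simp add: linear_sum[OF lin] linear_scale[OF lin] mult.commute)
  also have "(\<Sum>j\<in>UNIV. v $ j *\<^sub>R axis j 1) = v"
    using basis_expansion[of v] by (simp add: scalar_mult_eq_scaleR)
  finally show ?thesis .
qed

lemma matrix_inv_inverse:
  assumes "invertible M"
  shows "M ** matrix_inv M = mat 1" "matrix_inv M ** M = mat 1"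
  using someI_ex[OF assms[unfolded invertible_def]] unfolding matrix_inv_def by blast+

text \<open>The quadratic form of \<open>lam I + S\<close> dominates
  \<open>lam * (w \<bullet> w)\<close>, so the kernel is trivial and the square matrix is
  invertible.\<close>

lemma shifted_psd_matrix_inv:
  fixes S :: "real^'p^'p"
  assumes psd: "\<And>v. 0 \<le> v \<bullet> (S *v v)" and lam: "lam > 0"
  shows "(lam *\<^sub>R mat 1 + S) *v (matrix_inv (lam *\<^sub>R mat 1 + S) *v v) = v"
proof -
  let ?M = "lam *\<^sub>R mat 1 + S"
  have M: "?M *v w = lam *\<^sub>R w + S *v w" for w
    by (simp add: matrix_vector_mult_add_rdistrib flip: scaleR_matrix_vector_assoc)
  have "w = 0" if "?M *v w = 0" for w
  proof -
    have "lam * (w \<bullet> w) + w \<bullet> (S *v w) = w \<bullet> (?M *v w)" by (simp add: M inner_add_right)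
    also have "\<dots> = 0" using that by simp
    finally have "lam * (w \<bullet> w) \<le> 0" using psd[of w] by linarith
    then have "w \<bullet> w \<le> 0" using lam by (simp add: mult_le_0_iff)
    then show ?thesis by (metis inner_ge_zero inner_eq_zero_iff order_antisym)
  qed
  then have "\<exists>N. N ** ?M = mat 1"
    by (subst matrix_left_invertible_ker) blast
  then have "invertible ?M" by (simp add: invertible_left_inverse)
  then have "?M ** matrix_inv ?M = mat 1" by (simp add: matrix_inv_inverse)
  then show ?thesis by (simp add: matrix_vector_mul_assoc)
qed

text \<open>The Lyapunov function is \<open>L (\<theta> (k + 1)) + lam * (1 + mu) / 2 * \<eta> k * (norm (\<Delta>\<theta> k))\<^sup>2\<close>: the
  weight lies strictly between \<open>lam * mu\<close> and \<open>lam\<close>, so every step dissipates a multiple of both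
  \<open>(norm (\<Delta>\<theta> k))\<^sup>2\<close> and \<open>(norm (\<Delta>\<theta> (k - 1)))\<^sup>2\<close>, and these control the gradient through the
  update rule.\<close>

lemma momentum_gradient_sum_bound:
  fixes L :: "real^'p \<Rightarrow> real" and S :: "real^'p^'p"
  assumes deriv: "\<And>x v. ((\<lambda>t. L (x + t *\<^sub>R v)) has_real_derivative g x \<bullet> v) (at 0)"
    and bound: "\<And>x. L0 \<le> L x"
    and psd: "\<And>v. 0 \<le> v \<bullet> (S *v v)"
    and lam: "lam > 0" and mu: "0 \<le> mu" "mu < 1"
    and C: "C > 0" "C-lipschitz_on UNIV g"
    and eta: "\<And>k. k \<ge> 1 \<Longrightarrow> 0 < \<eta> k \<and> \<eta> k \<le> \<eta> (k - 1)"
    and eta0: "0 < \<eta> 0" "\<eta> 0 \<le> 2 * lam * (1 - mu) / C"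
    and update: "\<And>k. \<Delta> (int k) =
        matrix_inv (lam *\<^sub>R mat 1 + S) *v ((lam * mu) *\<^sub>R \<Delta> (int k - 1) - (1/2) *\<^sub>R g (\<theta> k))"
    and step: "\<And>k. \<theta> (Suc k) = \<theta> k + \<eta> k *\<^sub>R \<Delta> (int k)"
  shows "\<exists>C>0. \<forall>K\<ge>1. (\<Sum>k=1..K. \<eta> k * (norm (g (\<theta> k)))\<^sup>2) \<le> C"
proof -
  define T where "T = lam *\<^sub>R mat 1 + S"
  \<comment> \<open>Midpoint of \<open>lam * mu\<close> and \<open>lam\<close>;
    \<open>\<delta>\<close> is its distance to either end, hence the margin with which both squared
    momenta are dissipated.\<close>
  define c where "c = lam * (1 + mu) / 2"
  define \<delta> where "\<delta> = lam * (1 - mu) / 2"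
  have \<delta>: "0 < \<delta>" using lam mu by (simp add: \<delta>_def)
  define V where "V k = L (\<theta> (Suc k)) + c * \<eta> k * (norm (\<Delta> (int k)))\<^sup>2" for k
  have eta_pos: "0 < \<eta> k" for k using eta[of k] eta0 by (cases k) auto
  have eta_le: "\<eta> k \<le> \<eta> 0" for k
  proof (induction k)
    case (Suc k) then show ?case using eta[of "Suc k"] by simp
  qed simp
  have T: "T *v \<Delta> (int k) = (lam * mu) *\<^sub>R \<Delta> (int k - 1) - (1/2) *\<^sub>R g (\<theta> k)" for k
    unfolding T_def update[of k] by (rule shifted_psd_matrix_inv[OF psd lam])
  then have g: "g (\<theta> k) = 2 *\<^sub>R ((lam * mu) *\<^sub>R \<Delta> (int k - 1) - T *v \<Delta> (int k))" for k
    by (simp add: T)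
  define a where "a k = (norm (\<Delta> (int k)))\<^sup>2" for k
  \<comment> \<open>The predecessor of step \<open>Suc k\<close> has a step size
    \<open>\<eta> k\<close>; before step 0 there is none. So telescoping starts at
    \<open>V 0\<close>, which absorbs the initial data, and the sum starts at 1.\<close>
  have dissipation: "V (Suc k) \<le> V k - \<delta> * (\<eta> (Suc k) * (a (Suc k) + a k))" for k
  proof -
    define u where "u = \<Delta> (int (Suc k))"
    define u' where "u' = \<Delta> (int k)"
    define e where "e = \<eta> (Suc k)"
    have e: "0 < e" "e \<le> \<eta> k" using eta[of "Suc k"] by (auto simp: e_def)
    have au: "a (Suc k) = u \<bullet> u" "a k = u' \<bullet> u'"
      by (simp_all add: a_def u_def u'_def power2_norm_eq_inner)
    have Tu: "u \<bullet> (T *v u) \<ge> lam * (u \<bullet> u)"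
      using psd[of u]
      by (simp add: T_def matrix_vector_mult_add_rdistrib inner_add_right flip: scaleR_matrix_vector_assoc)
    have gu: "g (\<theta> (Suc k)) \<bullet> u = 2 * lam * mu * (u' \<bullet> u) - 2 * (u \<bullet> (T *v u))"
      unfolding g[of "Suc k"] by (simp add: u_def u'_def inner_diff_left inner_diff_right right_diff_distrib inner_commute)
    have "0 \<le> (u - u') \<bullet> (u - u')" by simp
    then have "2 * (u' \<bullet> u) \<le> u' \<bullet> u' + u \<bullet> u"
      by (simp add: inner_diff_left inner_diff_right inner_commute)
    then have "lam * mu * (2 * (u' \<bullet> u)) \<le> lam * mu * (u' \<bullet> u' + u \<bullet> u)"
      using lam mu by (intro mult_left_mono) auto
    then have gu': "g (\<theta> (Suc k)) \<bullet> u \<le> lam * mu * (u' \<bullet> u') + (lam * mu - 2 * lam) * (u \<bullet> u)"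
      using gu Tu by (simp add: algebra_simps)
    \<comment> \<open>The step-size bound is spent here: the curvature term costs at most
      \<open>lam * (1 - mu)\<close>, which raises the coefficient \<open>lam * mu - 2 * lam\<close>
      of \<open>u \<bullet> u\<close> to exactly \<open>- lam\<close>.\<close>
    have "C * e \<le> C * (2 * lam * (1 - mu) / C)"
      using C eta0 eta_le[of "Suc k"] by (intro mult_left_mono) (auto simp: e_def)
    then have Ce: "C * e / 2 \<le> lam * (1 - mu)" using C by simp
    have "L (\<theta> (Suc (Suc k))) \<le> L (\<theta> (Suc k)) + g (\<theta> (Suc k)) \<bullet> (e *\<^sub>R u) + C / 2 * (norm (e *\<^sub>R u))\<^sup>2"
      using descent_lemma[OF deriv C(2), of "\<theta> (Suc k)" "e *\<^sub>R u"] step[of "Suc k"] by (simp add: e_def u_def)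
    also have "(norm (e *\<^sub>R u))\<^sup>2 = e * (e * (u \<bullet> u))"
      by (simp add: power2_norm_eq_inner del: norm_scaleR)
    finally have "L (\<theta> (Suc (Suc k))) \<le> L (\<theta> (Suc k)) + e * (g (\<theta> (Suc k)) \<bullet> u + C * e / 2 * (u \<bullet> u))"
      by (simp add: algebra_simps)
    also have "\<dots> \<le> L (\<theta> (Suc k)) + e * ((lam * mu * (u' \<bullet> u') + (lam * mu - 2 * lam) * (u \<bullet> u))
        + lam * (1 - mu) * (u \<bullet> u))"
      using gu' Ce e by (intro add_left_mono mult_left_mono add_mono mult_right_mono) auto
    also have "\<dots> = L (\<theta> (Suc k)) + e * (lam * mu * (u' \<bullet> u') - lam * (u \<bullet> u))"
      by (simp add: algebra_simps)
    finally have 1: "L (\<theta> (Suc (Suc k))) \<le> L (\<theta> (Suc k)) + e * (lam * mu * (u' \<bullet> u') - lam * (u \<bullet> u))" .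
    \<comment> \<open>Step sizes do not increase, so the term stored in \<open>V k\<close> with
      weight \<open>\<eta> k\<close> covers the same term weighted by \<open>e\<close>; the
      remaining margins \<open>c - lam * mu\<close> and \<open>lam - c\<close> both equal
      \<open>\<delta>\<close>.\<close>
    have "c * (u' \<bullet> u') * e \<le> c * (u' \<bullet> u') * \<eta> k"
      using e lam mu by (intro mult_left_mono) (auto simp: c_def)
    moreover have "V (Suc k) = L (\<theta> (Suc (Suc k))) + c * (u \<bullet> u) * e" "V k = L (\<theta> (Suc k)) + c * (u' \<bullet> u') * \<eta> k"
      by (simp_all only: V_def u_def u'_def e_def power2_norm_eq_inner) simp_all
    ultimately show ?thesis
      unfolding au using 1 by (simp add: c_def \<delta>_def e_def[symmetric] field_simps)
  qed
  have telescope: "\<delta> * (\<Sum>k=1..K. \<eta> k * (a k + a (k - 1))) \<le> V 0 - V K" for K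
  proof (induction K)
    case (Suc K) then show ?case using dissipation[of K] by (simp add: algebra_simps)
  qed simp
  have V_ge: "L0 \<le> V k" for k
    unfolding V_def using bound[of "\<theta> (Suc k)"] eta_pos[of k] lam mu
    by (intro add_increasing2) (auto simp: c_def)
  obtain N where N: "\<And>v. norm (T *v v) \<le> norm v * N" "0 < N"
    using bounded_linear.pos_bounded[OF matrix_vector_mul_bounded_linear[of T]] by (auto simp: mult.commute)
  \<comment> \<open>The 8 is 4, from squaring the factor 2 in the formula for \<open>g\<close>,
    times 2, from bounding the square of \<open>x + y\<close> by twice the sum of squares.\<close>
  define B where "B = 8 * ((lam * mu)\<^sup>2 + N\<^sup>2)"
  have B: "0 < B" using N by (simp add: B_def add_nonneg_pos)
  have g_le: "(norm (g (\<theta> k)))\<^sup>2 \<le> B * (a k + a (k - 1))" if "k \<ge> 1" for k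
  proof -
    have k: "int k - 1 = int (k - 1)" using that by simp
    define x where "x = lam * mu * norm (\<Delta> (int (k - 1)))"
    define y where "y = N * norm (\<Delta> (int k))"
    have "norm ((lam * mu) *\<^sub>R \<Delta> (int (k - 1)) - T *v \<Delta> (int k)) \<le> x + y"
      using norm_triangle_ineq4[of "(lam * mu) *\<^sub>R \<Delta> (int (k - 1))" "T *v \<Delta> (int k)"] N(1)[of "\<Delta> (int k)"] lam mu
      by (simp add: x_def y_def abs_mult mult.commute)
    then have "norm (g (\<theta> k)) \<le> 2 * (x + y)"
      unfolding g[of k] k by simp
    then have "(norm (g (\<theta> k)))\<^sup>2 \<le> (2 * (x + y))\<^sup>2" by (rule power_mono) simp
    also have "\<dots> \<le> 8 * (x\<^sup>2 + y\<^sup>2)"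
      using sum_squares_bound[of x y] by (simp add: power2_eq_square algebra_simps)
    also have "\<dots> = 8 * ((lam * mu)\<^sup>2 * a (k - 1) + N\<^sup>2 * a k)"
      by (simp add: x_def y_def a_def power_mult_distrib)
    also have "\<dots> \<le> B * (a k + a (k - 1))"
      by (simp add: B_def a_def algebra_simps)
    finally show ?thesis .
  qed
  have "(\<Sum>k=1..K. \<eta> k * (norm (g (\<theta> k)))\<^sup>2) \<le> B / \<delta> * (V 0 - L0)" for K
  proof -
    have "(\<Sum>k=1..K. \<eta> k * (norm (g (\<theta> k)))\<^sup>2) \<le> (\<Sum>k=1..K. \<eta> k * (B * (a k + a (k - 1))))"
      using g_le eta_pos by (intro sum_mono mult_left_mono) (auto intro: less_imp_le)
    also have "\<dots> = B / \<delta> * (\<delta> * (\<Sum>k=1..K. \<eta> k * (a k + a (k - 1))))"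
      using \<delta> by (simp add: sum_distrib_left mult_ac)
    also have "\<dots> \<le> B / \<delta> * (V 0 - L0)"
      using telescope[of K] V_ge[of K] B \<delta> by (intro mult_left_mono) auto
    finally show ?thesis .
  qed
  then show ?thesis
    by (intro exI[of _ "max 1 (B / \<delta> * (V 0 - L0))"]) (auto simp: max.coboundedI2)
qed

section \<open>Integrability of Coulomb potentials against Gaussians\<close>

lemma nn_integral_lborel_shift:
  fixes a :: "'a::euclidean_space"
  assumes [measurable]: "f \<in> borel_measurable borel"
  shows "(\<integral>\<^sup>+x. f (a + x) \<partial>lborel) = (\<integral>\<^sup>+x. f x \<partial>lborel)"
proof -
  have "(\<integral>\<^sup>+x. f x \<partial>lborel) = (\<integral>\<^sup>+x. f x \<partial>distr lborel borel ((+) a))"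
    by (simp only: lborel_distr_plus)
  then show ?thesis by (simp add: nn_integral_distr)
qed

lemma integral_lborel_shift:
  fixes a :: "'a::euclidean_space" and f :: "'a \<Rightarrow> 'b::{banach, second_countable_topology}"
  assumes [measurable]: "f \<in> borel_measurable borel"
  shows "(\<integral>x. f (x - a) \<partial>lborel) = (\<integral>x. f x \<partial>lborel)"
proof -
  have "(\<integral>x. f x \<partial>lborel) = (\<integral>x. f x \<partial>distr lborel borel ((+) (- a)))"
    by (simp only: lborel_distr_plus)
  also have "\<dots> = (\<integral>x. f (- a + x) \<partial>lborel)" by (rule integral_distr) auto
  finally show ?thesis by simp
qed

lemma nn_integral_exp_sq_finite:
  assumes "c > 0"
  shows "(\<integral>\<^sup>+x. ennreal (exp (- c * (norm x)\<^sup>2)) \<partial>(lborel :: 'a::euclidean_space measure)) < \<infinity>"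
proof -
  \<comment> \<open>Standard deviation for which \<open>c * t^2 = t^2 / (2 * s^2)\<close>: the
    integrand is a multiple of a normal density, and in several dimensions the integral factors over
    the coordinates.\<close>
  define s where "s = sqrt (1 / (2 * c))"
  have s: "s > 0" "s\<^sup>2 = 1 / (2 * c)" using assms by (auto simp: s_def)
  have n: "exp (- c * t\<^sup>2) = sqrt (2 * pi * s\<^sup>2) * normal_density 0 s t" for t
    using assms s by (simp add: normal_density_def)
  have "integrable lborel (\<lambda>t. exp (- c * t\<^sup>2))"
    unfolding n by (intro integrable_mult_right integrable_normal_density s(1))
  then have fin: "(\<integral>\<^sup>+t. ennreal (exp (- c * t\<^sup>2)) \<partial>lborel) < \<infinity>"
    by (simp add: nn_integral_eq_integral)
  have "(\<integral>\<^sup>+x. ennreal (exp (- c * (norm x)\<^sup>2)) \<partial>(lborel :: 'a measure))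
      = (\<integral>\<^sup>+x. (\<Prod>b\<in>(Basis::'a set). ennreal (exp (- c * (x \<bullet> b)\<^sup>2))) \<partial>lborel)"
  proof (rule nn_integral_cong)
    fix x :: 'a
    have "- c * (norm x)\<^sup>2 = (\<Sum>b\<in>Basis. - c * (x \<bullet> b)\<^sup>2)"
      unfolding power2_norm_eq_inner euclidean_inner[of x x] by (simp add: sum_distrib_left power2_eq_square)
    then show "ennreal (exp (- c * (norm x)\<^sup>2)) = (\<Prod>b\<in>Basis. ennreal (exp (- c * (x \<bullet> b)\<^sup>2)))"
      by (simp only: exp_sum[OF finite_Basis] prod_ennreal[OF exp_ge_zero])
  qed
  also have "\<dots> = (\<Prod>b\<in>(Basis::'a set). \<integral>\<^sup>+t. ennreal (exp (- c * t\<^sup>2)) \<partial>lborel)"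
    by (rule nn_integral_lborel_prod) auto
  also have "\<dots> < \<infinity>"
    using fin by (simp add: power_less_top_ennreal)
  finally show ?thesis .
qed

text \<open>The punctured unit ball is covered by the dyadic balls of radius \<open>2 ^ (- n)\<close>, whose volumes,
  proportional to \<open>8 ^ (- n)\<close>, beat the size \<open>2 ^ (n + 1)\<close> of the integrand.\<close>

lemma nn_integral_inverse_norm_cball:
  "(\<integral>\<^sup>+u. ennreal (indicator (cball 0 1) u / norm u) \<partial>(lborel :: (real^3) measure)) < \<infinity>"
proof -
  let ?v = "unit_ball_vol 3"
  have [measurable]: "cball (0::real^3) r \<in> sets borel" for r by (rule borel_closed) simp
  have le: "ennreal (indicator (cball 0 1) u / norm u)
      \<le> (\<Sum>n. ennreal (2 ^ Suc n) * indicator (cball 0 ((1/2) ^ n)) u)" for u :: "real^3"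
  proof (cases "u \<in> cball 0 1 \<and> u \<noteq> 0")
    case True
    \<comment> \<open>The first dyadic radius below \<open>norm u\<close>. It is not the radius 1
      because \<open>norm u \<le> 1\<close>, so \<open>m = Suc n\<close>, \<open>u\<close> lies in
      ball \<open>n\<close>, and \<open>1 / norm u\<close> is at most \<open>2 ^ Suc n\<close>: one
      term of the series already dominates.\<close>
    define m where "m = (LEAST n. (1/2) ^ n < norm u)"
    have "\<exists>n. (1/2) ^ n < norm u" using True by (intro real_arch_pow_inv) auto
    then have m: "(1/2) ^ m < norm u" unfolding m_def by (rule LeastI_ex)
    moreover have "m \<noteq> 0" using m True by (intro notI) auto
    ultimately obtain n where n: "m = Suc n" by (cases m) auto
    then have "\<not> (1/2) ^ n < norm u" using not_less_Least[of n "\<lambda>n. (1/2) ^ n < norm u"] by (auto simp: m_def)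
    then have u: "u \<in> cball 0 ((1/2) ^ n)" by simp
    have "1 / norm u \<le> 1 / (1/2) ^ Suc n"
      using m n True by (intro divide_left_mono) (auto simp del: power_Suc)
    then have "ennreal (indicator (cball 0 1) u / norm u) \<le> ennreal (2 ^ Suc n) * indicator (cball 0 ((1/2) ^ n)) u"
      using u True by (simp add: power_one_over indicator_def field_simps del: power_Suc)
    also have "\<dots> = (\<Sum>k\<in>{n}. ennreal (2 ^ Suc k) * indicator (cball 0 ((1/2) ^ k)) u)"
      by (simp only: sum.insert sum.empty finite.emptyI empty_iff not_False_eq_True add_0_right)
    also have "\<dots> \<le> (\<Sum>n. ennreal (2 ^ Suc n) * indicator (cball 0 ((1/2) ^ n)) u)"
      by (rule sum_le_suminf) auto
    finally show ?thesis .
  next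
    case False
    \<comment> \<open>Either \<open>u\<close> lies outside the unit ball, or \<open>u = 0\<close>
      and \<open>1 / 0 = 0\<close>.\<close>
    then have "indicator (cball 0 1) u / norm u = (0::real)" by (auto simp: indicator_def)
    then show ?thesis by (simp only: ennreal_0 zero_le)
  qed
  have "(\<integral>\<^sup>+u. ennreal (indicator (cball 0 1) u / norm u) \<partial>(lborel :: (real^3) measure))
      \<le> (\<integral>\<^sup>+u. (\<Sum>n. ennreal (2 ^ Suc n) * indicator (cball 0 ((1/2) ^ n)) u) \<partial>(lborel :: (real^3) measure))"
    by (intro nn_integral_mono le)
  also have "\<dots> = (\<Sum>n. ennreal (2 ^ Suc n) * emeasure lborel (cball (0::real^3) ((1/2) ^ n)))"
    by (subst nn_integral_suminf) (auto simp: nn_integral_cmult_indicator)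
  also have "\<dots> = (\<Sum>n. ennreal (2 * ?v * (1/4) ^ n))"
  proof (rule suminf_cong)
    fix n
    have "((1/2::real) ^ n) ^ 3 = ((1/2) ^ 3) ^ n"
      by (simp only: power_mult[symmetric] mult.commute)
    then have "2 ^ Suc n * (?v * ((1/2) ^ n) ^ 3) = 2 * ?v * (2 ^ n * ((1/2) ^ 3) ^ n)" by simp
    also have "2 ^ n * ((1/2::real) ^ 3) ^ n = (1/4) ^ n"
      unfolding power_mult_distrib[symmetric] by (simp add: eval_nat_numeral)
    finally have "2 ^ Suc n * (?v * ((1/2) ^ n) ^ 3) = 2 * ?v * (1/4) ^ n" .
    then show "ennreal (2 ^ Suc n) * emeasure lborel (cball (0::real^3) ((1/2) ^ n)) = ennreal (2 * ?v * (1/4) ^ n)"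
      by (simp add: emeasure_cball del: power_Suc flip: ennreal_mult)
  qed
  also have "\<dots> < \<infinity>"
    by (subst suminf_ennreal2) (auto intro!: summable_mult summable_geometric)
  finally show ?thesis .
qed

text \<open>Where \<open>norm (z + u) > 1\<close> the integrand is below 1 and costs at most the
  volume of the ball; elsewhere it is dominated by a translate of the singular integral over the
  unit ball. Neither bound sees \<open>z\<close>.\<close>

lemma nn_integral_translated_inverse_norm:
  obtains K where "K \<ge> 0" "\<And>z::real^3. (\<integral>\<^sup>+u\<in>cball 0 1. ennreal (1 / norm (z + u)) \<partial>lborel) \<le> ennreal K"
proof -
  let ?I = "\<integral>\<^sup>+u. ennreal (indicator (cball 0 1) u / norm u) \<partial>(lborel :: (real^3) measure)"
  have [measurable]: "cball (0::real^3) r \<in> sets borel" for r by (rule borel_closed) simp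
  let ?B = "emeasure lborel (cball (0::real^3) 1)"
  have fin: "?B + ?I < \<infinity>"
    using nn_integral_inverse_norm_cball by (simp add: emeasure_cball)
  have "(\<integral>\<^sup>+u\<in>cball 0 1. ennreal (1 / norm (z + u)) \<partial>lborel) \<le> ?B + ?I" for z :: "real^3"
  proof -
    have "(\<integral>\<^sup>+u\<in>cball 0 1. ennreal (1 / norm (z + u)) \<partial>lborel)
        \<le> (\<integral>\<^sup>+u. indicator (cball 0 1) u + ennreal (indicator (cball 0 1) (z + u) / norm (z + u)) \<partial>lborel)"
    proof (rule nn_integral_mono)
      fix u :: "real^3"
      show "ennreal (1 / norm (z + u)) * indicator (cball 0 1) u
          \<le> indicator (cball 0 1) u + ennreal (indicator (cball 0 1) (z + u) / norm (z + u))"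
      proof (cases "norm (z + u) \<le> 1")
        case False
        then have "1 / norm (z + u) \<le> 1" by (simp add: divide_le_eq_1)
        then show ?thesis using ennreal_leI[of "1 / norm (z + u)" 1] by (simp add: indicator_def)
      qed (auto simp: indicator_def intro: add_increasing)
    qed
    also have "\<dots> = ?B + (\<integral>\<^sup>+u. ennreal (indicator (cball 0 1) (z + u) / norm (z + u)) \<partial>lborel)"
      by (subst nn_integral_add) auto
    also have "(\<integral>\<^sup>+u. ennreal (indicator (cball 0 1) (z + u) / norm (z + u)) \<partial>lborel) = ?I"
      by (rule nn_integral_lborel_shift[where f="\<lambda>u. ennreal (indicator (cball 0 1) u / norm u)"]) simp
    finally show ?thesis .
  qed
  then show thesis
    using fin by (intro that[of "enn2real (?B + ?I)"]) (auto simp: less_top)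
qed

text \<open>The constant may depend on the rate \<open>c\<close> but not on the centre
  \<open>w\<close>. All rates are required because the estimates keep trading decay for polynomial
  factors and displacements.\<close>

definition gauss_bounded :: "('a::euclidean_space \<Rightarrow> real) \<Rightarrow> bool"
  where "gauss_bounded V \<longleftrightarrow> V \<in> borel_measurable borel \<and>
    (\<forall>c>0. \<exists>K\<ge>0. \<forall>w. (\<integral>\<^sup>+x. ennreal (\<bar>V x\<bar> * exp (- c * (norm (x - w))\<^sup>2)) \<partial>lborel) \<le> ennreal K)"

section \<open>Closure of \<open>gauss_bounded\<close> under linear combinations\<close>

lemma gauss_bounded_measurable: "gauss_bounded V \<Longrightarrow> V \<in> borel_measurable borel"
  by (simp add: gauss_bounded_def)

lemma gauss_boundedE:
  assumes "gauss_bounded V" "c > 0"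
  obtains K where "K \<ge> 0"
    "\<And>w. (\<integral>\<^sup>+x. ennreal (\<bar>V x\<bar> * exp (- c * (norm (x - w))\<^sup>2)) \<partial>lborel) \<le> ennreal K"
  using assms by (auto simp: gauss_bounded_def)

lemma gauss_bounded_const: "gauss_bounded (\<lambda>x::'a::euclidean_space. a)"
proof -
  have "\<exists>K\<ge>0. \<forall>w::'a. (\<integral>\<^sup>+x. ennreal (\<bar>a\<bar> * exp (- c * (norm (x - w))\<^sup>2)) \<partial>lborel) \<le> ennreal K"
    if c: "c > 0" for c
  proof -
    let ?I = "\<integral>\<^sup>+x. ennreal (exp (- c * (norm x)\<^sup>2)) \<partial>(lborel :: 'a measure)"
    obtain K where K: "K \<ge> 0" "?I = ennreal K"
      using nn_integral_exp_sq_finite[OF c, where 'a='a] by (cases ?I) auto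
    have "(\<integral>\<^sup>+x. ennreal (\<bar>a\<bar> * exp (- c * (norm (x - w))\<^sup>2)) \<partial>lborel) = ennreal (\<bar>a\<bar> * K)" for w :: 'a
    proof -
      have "(\<integral>\<^sup>+x. ennreal (\<bar>a\<bar> * exp (- c * (norm (x - w))\<^sup>2)) \<partial>lborel)
          = ennreal \<bar>a\<bar> * (\<integral>\<^sup>+x. ennreal (exp (- c * (norm (- w + x))\<^sup>2)) \<partial>lborel)"
        by (simp add: ennreal_mult nn_integral_cmult)
      also have "(\<integral>\<^sup>+x. ennreal (exp (- c * (norm (- w + x))\<^sup>2)) \<partial>lborel) = ?I"
        by (rule nn_integral_lborel_shift[where f="\<lambda>x. ennreal (exp (- c * (norm x)\<^sup>2))"]) simp
      finally show ?thesis using K by (simp add: ennreal_mult)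
    qed
    then show ?thesis using K by (intro exI[of _ "\<bar>a\<bar> * K"]) auto
  qed
  then show ?thesis by (simp add: gauss_bounded_def)
qed

lemma gauss_bounded_add:
  assumes V: "gauss_bounded V" and W: "gauss_bounded W"
  shows "gauss_bounded (\<lambda>x. V x + W x)"
proof -
  note [measurable] = gauss_bounded_measurable[OF V] gauss_bounded_measurable[OF W]
  have "\<exists>K\<ge>0. \<forall>w. (\<integral>\<^sup>+x. ennreal (\<bar>V x + W x\<bar> * exp (- c * (norm (x - w))\<^sup>2)) \<partial>lborel) \<le> ennreal K"
    if c: "c > 0" for c
  proof -
    obtain K where K: "K \<ge> 0"
      "\<And>w. (\<integral>\<^sup>+x. ennreal (\<bar>V x\<bar> * exp (- c * (norm (x - w))\<^sup>2)) \<partial>lborel) \<le> ennreal K"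
      using gauss_boundedE[OF V c] by blast
    obtain K' where K': "K' \<ge> 0"
      "\<And>w. (\<integral>\<^sup>+x. ennreal (\<bar>W x\<bar> * exp (- c * (norm (x - w))\<^sup>2)) \<partial>lborel) \<le> ennreal K'"
      using gauss_boundedE[OF W c] by blast
    have "(\<integral>\<^sup>+x. ennreal (\<bar>V x + W x\<bar> * exp (- c * (norm (x - w))\<^sup>2)) \<partial>lborel) \<le> ennreal (K + K')" for w
    proof -
      have "(\<integral>\<^sup>+x. ennreal (\<bar>V x + W x\<bar> * exp (- c * (norm (x - w))\<^sup>2)) \<partial>lborel)
         \<le> (\<integral>\<^sup>+x. ennreal (\<bar>V x\<bar> * exp (- c * (norm (x - w))\<^sup>2))
              + ennreal (\<bar>W x\<bar> * exp (- c * (norm (x - w))\<^sup>2)) \<partial>lborel)"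
        by (intro nn_integral_mono)
          (auto simp: distrib_right[symmetric] simp flip: ennreal_plus intro!: ennreal_leI mult_right_mono)
      also have "\<dots> \<le> ennreal K + ennreal K'"
        using add_mono[OF K(2)[of w] K'(2)[of w]] by (subst nn_integral_add) simp_all
      finally show ?thesis using K K' by simp
    qed
    then show ?thesis using K K' by (intro exI[of _ "K + K'"]) auto
  qed
  then show ?thesis by (simp add: gauss_bounded_def)
qed

lemma gauss_bounded_cmult:
  assumes V: "gauss_bounded V"
  shows "gauss_bounded (\<lambda>x. a * V x)"
proof -
  note [measurable] = gauss_bounded_measurable[OF V]
  have "\<exists>K\<ge>0. \<forall>w. (\<integral>\<^sup>+x. ennreal (\<bar>a * V x\<bar> * exp (- c * (norm (x - w))\<^sup>2)) \<partial>lborel) \<le> ennreal K"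
    if c: "c > 0" for c
  proof -
    obtain K where K: "K \<ge> 0"
      "\<And>w. (\<integral>\<^sup>+x. ennreal (\<bar>V x\<bar> * exp (- c * (norm (x - w))\<^sup>2)) \<partial>lborel) \<le> ennreal K"
      using gauss_boundedE[OF V c] by blast
    have "(\<integral>\<^sup>+x. ennreal (\<bar>a * V x\<bar> * exp (- c * (norm (x - w))\<^sup>2)) \<partial>lborel) \<le> ennreal (\<bar>a\<bar> * K)" for w
      using K by (simp add: abs_mult mult.assoc ennreal_mult nn_integral_cmult mult_left_mono)
    then show ?thesis using K by (intro exI[of _ "\<bar>a\<bar> * K"]) auto
  qed
  then show ?thesis by (simp add: gauss_bounded_def)
qed

lemma gauss_bounded_sum:
  assumes "\<And>i. i \<in> I \<Longrightarrow> gauss_bounded (V i)"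
  shows "gauss_bounded (\<lambda>x. \<Sum>i\<in>I. V i x)"
  using assms
  by (induction I rule: infinite_finite_induct) (simp_all add: gauss_bounded_const gauss_bounded_add)

text \<open>Displacing a Gaussian costs half of its rate and a factor depending only on the size of
  the displacement. Behind this is the nonnegative square of \<open>y + 2u\<close>, rearranged. It
  serves both the averaging of singularities and the bound on difference quotients.\<close>

lemma exp_sq_shift_le:
  fixes y u :: "'a::real_inner"
  assumes "c \<ge> 0"
  shows "exp (- c * (norm (y + u))\<^sup>2) \<le> exp (c * (norm u)\<^sup>2) * exp (- (c/2) * (norm y)\<^sup>2)"
proof -
  have "0 \<le> (y + 2 *\<^sub>R u) \<bullet> (y + 2 *\<^sub>R u)" by simp
  then have "(norm y)\<^sup>2 \<le> 2 * (norm (y + u))\<^sup>2 + 2 * (norm u)\<^sup>2"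
    unfolding power2_norm_eq_inner by (simp add: inner_add_left inner_add_right inner_commute)
  then have "c * (norm y)\<^sup>2 \<le> c * (2 * (norm (y + u))\<^sup>2 + 2 * (norm u)\<^sup>2)"
    using assms by (rule mult_left_mono)
  then show ?thesis by (simp add: algebra_simps flip: exp_add)
qed

text \<open>A Coulomb singularity is averaged over displacements of one particle in the unit ball of
  \<open>\<real>\<^sup>3\<close>: Lebesgue measure does not notice the displacement, the Gaussian weight changes only by
  a bounded factor and a wider variance, and the average of the singularity is bounded.\<close>

lemma gauss_bounded_inverse_norm:
  fixes \<iota> :: "real^3 \<Rightarrow> 'a::euclidean_space" and l :: "'a \<Rightarrow> real^3"
  assumes l[measurable]: "l \<in> borel_measurable borel" and \<iota>[measurable]: "\<iota> \<in> borel_measurable borel"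
    and norm_\<iota>: "\<And>u. norm (\<iota> u) = norm u"
    and l_\<iota>: "\<And>x u. l (x + \<iota> u) = l x + u"
  shows "gauss_bounded (\<lambda>x. 1 / norm (l x))"
proof -
  have [measurable]: "cball (0::real^3) r \<in> sets borel" for r by (rule borel_closed) simp
  define b where "b = unit_ball_vol 3"
  have b: "b > 0" by (simp add: b_def)
  have vol: "emeasure lborel (cball (0::real^3) 1) = ennreal b"
    by (simp add: emeasure_cball b_def)
  obtain K where K: "K \<ge> 0" "\<And>z::real^3. (\<integral>\<^sup>+u\<in>cball 0 1. ennreal (1 / norm (z + u)) \<partial>lborel) \<le> ennreal K"
    using nn_integral_translated_inverse_norm by blast
  have "\<exists>K\<ge>0. \<forall>w. (\<integral>\<^sup>+x. ennreal (\<bar>1 / norm (l x)\<bar> * exp (- c * (norm (x - w))\<^sup>2)) \<partial>lborel) \<le> ennreal K"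
    if c: "c > 0" for c
  proof -
    obtain K' where K': "K' \<ge> 0"
      "\<And>w::'a. (\<integral>\<^sup>+x. ennreal (\<bar>1\<bar> * exp (- (c/2) * (norm (x - w))\<^sup>2)) \<partial>lborel) \<le> ennreal K'"
      using gauss_boundedE[OF gauss_bounded_const, of "c/2" 1] c by auto
    have "(\<integral>\<^sup>+x. ennreal (\<bar>1 / norm (l x)\<bar> * exp (- c * (norm (x - w))\<^sup>2)) \<partial>lborel)
        \<le> ennreal (exp c * K' * K / b)" (is "?I \<le> _") for w
    proof -
      define f where "f x = ennreal (1 / norm (l x) * exp (- c * (norm (x - w))\<^sup>2))" for x
      have [measurable]: "f \<in> borel_measurable borel" unfolding f_def by measurable
      have I: "?I = (\<integral>\<^sup>+x. f x \<partial>lborel)" by (simp add: f_def)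
      have "ennreal b * ?I = (\<integral>\<^sup>+u\<in>cball (0::real^3) 1. ?I \<partial>lborel)"
        by (subst nn_integral_cmult_indicator) (simp_all add: vol mult.commute)
      also have "\<dots> = (\<integral>\<^sup>+u. (\<integral>\<^sup>+x. f (x + \<iota> u) * indicator (cball (0::real^3) 1) u \<partial>lborel) \<partial>lborel)"
        unfolding I by (subst nn_integral_multc)
          (simp_all add: nn_integral_lborel_shift[of f "\<iota> _"] add.commute[of _ "\<iota> _"])
      \<comment> \<open>After the exchange the singularity is integrated over \<open>u\<close> with
        \<open>x\<close> fixed and is bounded by \<open>K\<close> wherever \<open>l x\<close> lies;
        what remains in \<open>x\<close> is a pure Gaussian of rate \<open>c/2\<close>, bounded by
        \<open>K'\<close> for every centre.\<close>
      also have "\<dots> = (\<integral>\<^sup>+x. (\<integral>\<^sup>+u. f (x + \<iota> u) * indicator (cball (0::real^3) 1) u \<partial>lborel) \<partial>lborel)"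
        by (rule lborel_pair.Fubini') measurable
      also have "\<dots> \<le> (\<integral>\<^sup>+x. (\<integral>\<^sup>+u. ennreal (exp c * exp (- (c/2) * (norm (x - w))\<^sup>2))
          * (ennreal (1 / norm (l x + u)) * indicator (cball (0::real^3) 1) u) \<partial>lborel) \<partial>lborel)"
      proof (intro nn_integral_mono)
        fix x and u :: "real^3"
        show "f (x + \<iota> u) * indicator (cball (0::real^3) 1) u
            \<le> ennreal (exp c * exp (- (c/2) * (norm (x - w))\<^sup>2))
              * (ennreal (1 / norm (l x + u)) * indicator (cball (0::real^3) 1) u)"
        proof (cases "norm u \<le> 1")
          case True
          have "exp (- c * (norm (x + \<iota> u - w))\<^sup>2) \<le> exp (c * (norm u)\<^sup>2) * exp (- (c/2) * (norm (x - w))\<^sup>2)"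
            using exp_sq_shift_le[of c "x - w" "\<iota> u"] c by (simp add: norm_\<iota> algebra_simps)
          also have "\<dots> \<le> exp c * exp (- (c/2) * (norm (x - w))\<^sup>2)"
            using True c by (intro mult_right_mono) (auto simp: power_le_one)
          finally have "1 / norm (l x + u) * exp (- c * (norm (x + \<iota> u - w))\<^sup>2)
              \<le> 1 / norm (l x + u) * (exp c * exp (- (c/2) * (norm (x - w))\<^sup>2))"
            by (intro mult_left_mono) auto
          then have "f (x + \<iota> u) \<le> ennreal (1 / norm (l x + u) * (exp c * exp (- (c/2) * (norm (x - w))\<^sup>2)))"
            unfolding f_def l_\<iota> by (rule ennreal_leI)
          also have "\<dots> = ennreal (exp c * exp (- (c/2) * (norm (x - w))\<^sup>2)) * ennreal (1 / norm (l x + u))"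
            by (subst ennreal_mult[symmetric]) (simp_all add: mult_ac)
          finally show ?thesis using True by simp
        qed simp
      qed
      also have "\<dots> = (\<integral>\<^sup>+x. ennreal (exp c * exp (- (c/2) * (norm (x - w))\<^sup>2))
          * (\<integral>\<^sup>+u\<in>cball (0::real^3) 1. ennreal (1 / norm (l x + u)) \<partial>lborel) \<partial>lborel)"
        by (subst nn_integral_cmult) auto
      also have "\<dots> \<le> (\<integral>\<^sup>+x. ennreal (exp c * exp (- (c/2) * (norm (x - w))\<^sup>2)) * ennreal K \<partial>lborel)"
        by (intro nn_integral_mono mult_left_mono K) auto
      also have "\<dots> = ennreal (exp c * K) * (\<integral>\<^sup>+x. ennreal (exp (- (c/2) * (norm (x - w))\<^sup>2)) \<partial>lborel)"
        using K by (subst nn_integral_cmult[symmetric]) (auto simp: mult_ac simp flip: ennreal_mult)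
      also have "\<dots> \<le> ennreal (exp c * K) * ennreal K'"
        using K'(2)[of w] by (intro mult_left_mono) auto
      finally have le: "ennreal b * ?I \<le> ennreal (exp c * K * K')"
        using K K' by (simp add: ennreal_mult)
      have "?I = ennreal (1 / b) * (ennreal b * ?I)"
        using b by (simp add: mult.assoc[symmetric] flip: ennreal_mult)
      also have "\<dots> \<le> ennreal (1 / b) * ennreal (exp c * K * K')"
        using le by (rule mult_left_mono) simp
      also have "\<dots> = ennreal (exp c * K' * K / b)"
        using b K K' by (subst ennreal_mult[symmetric]) (auto simp: mult_ac)
      finally show ?thesis .
    qed
    then show ?thesis using K K' b by (intro exI[of _ "exp c * K' * K / b"]) auto
  qed
  then show ?thesis by (simp add: gauss_bounded_def)
qed

text \<open>\<open>\<iota> i\<close> displaces electron \<open>i\<close> alone. This shifts both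
  \<open>electron_pos x i - r\<close> and, for \<open>i \<noteq> j\<close>,
  \<open>electron_pos x i - electron_pos x j\<close> by the displacement, so each singular term fits
  \<open>gauss_bounded_inverse_norm\<close>; the repulsion between nuclei is a constant.\<close>

lemma gauss_bounded_coulomb_potential:
  "gauss_bounded (coulomb_potential M Z R :: real^('n::{finite,linorder} \<times> 3) \<Rightarrow> real)"
proof -
  have pos[measurable]: "(\<lambda>x::real^('n \<times> 3). electron_pos x i) \<in> borel_measurable borel" for i
    unfolding electron_pos_def by (intro borel_measurable_continuous_onI continuous_intros)
  define \<iota> where "\<iota> i u = (\<chi> p. if fst p = i then u $ snd p else 0)" for i :: 'n and u :: "real^3"
  have \<iota>[measurable]: "\<iota> i \<in> borel_measurable borel" for i
    unfolding \<iota>_def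
  proof (intro borel_measurable_continuous_onI continuous_on_vec_lambda)
    show "continuous_on UNIV (\<lambda>u::real^3. if fst p = i then u $ snd p else 0)" for p
      by (cases "fst p = i") (auto intro!: continuous_intros)
  qed
  have norm_\<iota>: "norm (\<iota> i u) = norm u" for i u
  proof -
    have "\<iota> i u \<bullet> \<iota> i u = (\<Sum>(j, k)\<in>UNIV \<times> UNIV. if j = i then u $ k * u $ k else 0)"
      by (auto simp: inner_vec_def \<iota>_def intro!: sum.cong)
    also have "\<dots> = (\<Sum>j\<in>UNIV. if j = i then (\<Sum>k\<in>UNIV. u $ k * u $ k) else 0)"
      by (subst sum.cartesian_product[symmetric]) (rule sum.cong[OF refl], simp)
    also have "\<dots> = u \<bullet> u" by (simp add: inner_vec_def)
    finally show ?thesis by (simp add: norm_eq_sqrt_inner)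
  qed
  have pos_\<iota>: "electron_pos (x + \<iota> i u) j = electron_pos x j + (if j = i then u else 0)" for x i j u
    by (simp add: electron_pos_def \<iota>_def vec_eq_iff)
  have nuc: "gauss_bounded (\<lambda>x::real^('n \<times> 3). 1 / norm (electron_pos x i - r))" for i r
    by (rule gauss_bounded_inverse_norm[of _ "\<iota> i"]) (simp_all add: norm_\<iota> pos_\<iota>)
  have elec: "gauss_bounded (\<lambda>x::real^('n \<times> 3). 1 / norm (electron_pos x i - electron_pos x j))"
    if "i \<noteq> j" for i j
    using that by (intro gauss_bounded_inverse_norm[of _ "\<iota> i"]) (auto simp: norm_\<iota> pos_\<iota>)
  have "gauss_bounded (\<lambda>x::real^('n \<times> 3).
      (- 1) * (\<Sum>i\<in>UNIV. \<Sum>I=1..M. real (Z I) * (1 / norm (electron_pos x i - R I)))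
      + (\<Sum>p\<in>{(i, j). i < j}. 1 / norm (electron_pos x (fst p) - electron_pos x (snd p)))
      + (\<Sum>I=1..M. \<Sum>I'\<in>{I<..M}. real (Z I) * real (Z I') / norm (R I - R I')))"
    by (intro gauss_bounded_add gauss_bounded_cmult gauss_bounded_sum gauss_bounded_const nuc elec) auto
  then show ?thesis
    unfolding coulomb_potential_def[abs_def] by (simp add: case_prod_beta)
qed

section \<open>Convolution with a Gaussian\<close>

lemma gauss_bounded_times:
  assumes V: "gauss_bounded V" and f[measurable]: "f \<in> borel_measurable borel"
    and c: "c > 0" and f_le: "\<And>x. \<bar>f x\<bar> \<le> B * exp (- c * (norm (x - w))\<^sup>2)"
  shows "integrable lborel (\<lambda>x. V x * f x)"
proof -
  note [measurable] = gauss_bounded_measurable[OF V]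
  obtain K where K: "K \<ge> 0"
    "\<And>w. (\<integral>\<^sup>+x. ennreal (\<bar>V x\<bar> * exp (- c * (norm (x - w))\<^sup>2)) \<partial>lborel) \<le> ennreal K"
    using gauss_boundedE[OF V c] by blast
  have "integrable lborel (\<lambda>x. \<bar>V x\<bar> * exp (- c * (norm (x - w))\<^sup>2))"
    by (rule integrableI_bounded) (use K(2)[of w] in \<open>auto simp: abs_mult intro: le_less_trans\<close>)
  then have "integrable lborel (\<lambda>x. B * (\<bar>V x\<bar> * exp (- c * (norm (x - w))\<^sup>2)))"
    by (rule integrable_mult_right)
  then show ?thesis
  proof (rule Bochner_Integration.integrable_bound)
    show "AE x in lborel. norm (V x * f x) \<le> norm (B * (\<bar>V x\<bar> * exp (- c * (norm (x - w))\<^sup>2)))"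
    proof (rule AE_I2)
      fix x
      have "\<bar>V x\<bar> * \<bar>f x\<bar> \<le> \<bar>V x\<bar> * (B * exp (- c * (norm (x - w))\<^sup>2))"
        by (intro mult_left_mono f_le) auto
      also have "\<dots> \<le> \<bar>V x\<bar> * (\<bar>B\<bar> * exp (- c * (norm (x - w))\<^sup>2))"
        by (intro mult_left_mono mult_right_mono) auto
      finally show "norm (V x * f x) \<le> norm (B * (\<bar>V x\<bar> * exp (- c * (norm (x - w))\<^sup>2)))"
        by (simp add: abs_mult mult_ac)
    qed
  qed simp
qed

text \<open>\<open>P\<close> stands for the inverse covariance and \<open>m\<close> for a positive
  lower bound of its quadratic form on unit vectors.\<close>

locale gaussian_weight =
  fixes P :: "real^'d^'d" and m :: real
  assumes sym: "x \<bullet> (P *v y) = y \<bullet> (P *v x)"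
    and m_pos: "m > 0"
    and coercive: "m * (norm y)\<^sup>2 \<le> y \<bullet> (P *v y)"
begin

text \<open>The unnormalised Born density centred at 0: the square of the wavefunction profile,
  hence 1/2 in the exponent instead of 1/4.\<close>

definition G :: "real^'d \<Rightarrow> real"
  where "G y = exp (- (y \<bullet> (P *v y)) / 2)"

lemma G_nonneg [simp]: "0 \<le> G y"
  by (simp add: G_def)

lemma G_measurable [measurable]: "G \<in> borel_measurable borel"
  unfolding G_def by (intro borel_measurable_continuous_onI continuous_intros matrix_vector_mult_linear_continuous_on) auto

lemma G_le: "G y \<le> exp (- (m/2) * (norm y)\<^sup>2)"
  using coercive[of y] by (simp add: G_def)

text \<open>Half of the decay pays for the polynomial: \<open>t \<le> exp t\<close> at
  \<open>t = (m/4) * (norm y)^2\<close> yields the constant \<open>4/m\<close>, and the other half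
  survives. Degree two covers first derivatives of \<open>G\<close>, products of two scores and the
  kinetic term.\<close>

lemma G_poly_le: "(1 + (norm y)\<^sup>2) * G y \<le> (1 + 4/m) * exp (- (m/4) * (norm y)\<^sup>2)"
proof -
  let ?e = "exp (- (m/4) * (norm y)\<^sup>2)"
  have "(m/4) * (norm y)\<^sup>2 \<le> exp ((m/4) * (norm y)\<^sup>2)"
    by (rule order_trans[OF _ exp_ge_add_one_self]) simp
  then have "(norm y)\<^sup>2 * ?e \<le> 4/m"
    using m_pos by (simp add: exp_minus field_simps)
  moreover have "?e \<le> 1" using m_pos by simp
  ultimately have "(1 + (norm y)\<^sup>2) * ?e \<le> 1 + 4/m" unfolding distrib_right mult_1_left by linarith
  then have "(1 + (norm y)\<^sup>2) * ?e * ?e \<le> (1 + 4/m) * ?e" by (rule mult_right_mono) simp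
  moreover have "?e * ?e = exp (- (m/2) * (norm y)\<^sup>2)" by (simp flip: exp_add)
  ultimately have "(1 + (norm y)\<^sup>2) * exp (- (m/2) * (norm y)\<^sup>2) \<le> (1 + 4/m) * ?e"
    by (simp only: mult.assoc)
  moreover have "(1 + (norm y)\<^sup>2) * G y \<le> (1 + (norm y)\<^sup>2) * exp (- (m/2) * (norm y)\<^sup>2)"
    by (intro mult_left_mono G_le) simp
  ultimately show ?thesis by (rule order_trans[rotated])
qed

lemma integrable_poly:
  fixes f :: "real^'d \<Rightarrow> 'b::{banach, second_countable_topology}"
  assumes [measurable]: "f \<in> borel_measurable borel"
    and f_le: "\<And>y. norm (f y) \<le> C * (1 + (norm y)\<^sup>2)"
  shows "integrable lborel (\<lambda>x. G (x - w) *\<^sub>R f (x - w))"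
proof -
  have "integrable lborel (\<lambda>x::real^'d. 1 * (C * ((1 + 4/m) * exp (- (m/4) * (norm (x - w))\<^sup>2))))"
    by (rule gauss_bounded_times[OF gauss_bounded_const, where c="m/4" and w=w and B="\<bar>C\<bar> * (1 + 4/m)"])
      (use m_pos in \<open>auto simp: abs_mult mult_ac\<close>)
  then show ?thesis
  proof (rule Bochner_Integration.integrable_bound)
    have C: "C \<ge> 0" using order_trans[OF norm_ge_zero f_le[of 0]] by simp
    show "AE x in lborel. norm (G (x - w) *\<^sub>R f (x - w))
        \<le> norm (1 * (C * ((1 + 4/m) * exp (- (m/4) * (norm (x - w))\<^sup>2))))"
    proof (rule AE_I2)
      fix x
      have "norm (G (x - w) *\<^sub>R f (x - w)) \<le> G (x - w) * (C * (1 + (norm (x - w))\<^sup>2))"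
        using f_le[of "x - w"] by (simp add: mult_left_mono)
      also have "\<dots> = C * ((1 + (norm (x - w))\<^sup>2) * G (x - w))" by simp
      also have "\<dots> \<le> C * ((1 + 4/m) * exp (- (m/4) * (norm (x - w))\<^sup>2))"
        by (intro mult_left_mono G_poly_le C)
      finally show "norm (G (x - w) *\<^sub>R f (x - w))
        \<le> norm (1 * (C * ((1 + 4/m) * exp (- (m/4) * (norm (x - w))\<^sup>2))))"
        using C m_pos by simp
    qed
  qed simp
qed

lemma integrable_gauss_bounded:
  assumes V: "gauss_bounded V"
  shows "integrable lborel (\<lambda>x. V x * G (x - w))"
  using G_le m_pos by (intro gauss_bounded_times[OF V, of _ "m/2" 1 w]) auto

lemma inner_P_le:
  obtains N where "N \<ge> 0" "\<And>y. \<bar>y \<bullet> (P *v a)\<bar> \<le> N * (1 + (norm y)\<^sup>2)"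
proof (rule that)
  fix y :: "real^'d"
  have "\<bar>y \<bullet> (P *v a)\<bar> \<le> norm (P *v a) * norm y"
    using Cauchy_Schwarz_ineq2[of y "P *v a"] by (simp add: mult.commute)
  also have "norm y \<le> 1 + (norm y)\<^sup>2"
    using sum_squares_bound[of 1 "norm y"] norm_ge_zero[of y] unfolding power_one mult_1_right by linarith
  finally show "\<bar>y \<bullet> (P *v a)\<bar> \<le> norm (P *v a) * (1 + (norm y)\<^sup>2)" by (simp add: mult_left_mono)
qed simp

lemma integrable_gauss_bounded_inner:
  assumes V: "gauss_bounded V"
  shows "integrable lborel (\<lambda>x. V x * (G (x - w) * ((x - w) \<bullet> (P *v a))))"
proof -
  obtain N where N: "N \<ge> 0" "\<And>y. \<bar>y \<bullet> (P *v a)\<bar> \<le> N * (1 + (norm y)\<^sup>2)"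
    using inner_P_le[of a] by blast
  show ?thesis
  proof (rule gauss_bounded_times[OF V])
    fix x
    have "\<bar>G (x - w) * ((x - w) \<bullet> (P *v a))\<bar> \<le> G (x - w) * (N * (1 + (norm (x - w))\<^sup>2))"
      using N(2)[of "x - w"] by (simp add: abs_mult mult_left_mono)
    also have "\<dots> = N * ((1 + (norm (x - w))\<^sup>2) * G (x - w))" by simp
    also have "\<dots> \<le> N * ((1 + 4/m) * exp (- (m/4) * (norm (x - w))\<^sup>2))"
      by (intro mult_left_mono G_poly_le N)
    finally show "\<bar>G (x - w) * ((x - w) \<bullet> (P *v a))\<bar> \<le> N * (1 + 4/m) * exp (- (m/4) * (norm (x - w))\<^sup>2)"
      by (simp add: mult.assoc)
  qed (use m_pos in auto)
qed

text \<open>Uniformity in the centre bounds the potential energy for all parameters at once, which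
  is where the lower bound on the energy comes from.\<close>

lemma weighted_integral_bounded:
  assumes V: "gauss_bounded V"
  obtains K where "\<And>w. \<bar>\<integral>x. V x * G (x - w) \<partial>lborel\<bar> \<le> K"
proof -
  note [measurable] = gauss_bounded_measurable[OF V]
  obtain K where K: "K \<ge> 0"
    "\<And>w. (\<integral>\<^sup>+x. ennreal (\<bar>V x\<bar> * exp (- (m/2) * (norm (x - w))\<^sup>2)) \<partial>lborel) \<le> ennreal K"
    using gauss_boundedE[OF V, of "m/2"] m_pos by auto
  have "\<bar>\<integral>x. V x * G (x - w) \<partial>lborel\<bar> \<le> K" for w
  proof -
    have "ennreal (norm (\<integral>x. V x * G (x - w) \<partial>lborel)) \<le> (\<integral>\<^sup>+x. ennreal (norm (V x * G (x - w))) \<partial>lborel)"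
      by (rule integral_norm_bound_ennreal[OF integrable_gauss_bounded[OF V]])
    also have "\<dots> \<le> (\<integral>\<^sup>+x. ennreal (\<bar>V x\<bar> * exp (- (m/2) * (norm (x - w))\<^sup>2)) \<partial>lborel)"
      by (intro nn_integral_mono ennreal_leI) (use G_le in \<open>simp add: abs_mult mult_left_mono\<close>)
    also note K(2)
    finally show ?thesis using K(1) by simp
  qed
  then show thesis by (rule that)
qed

section \<open>Differentiating the convolution along a line\<close>

lemma G_line_derivative:
  "((\<lambda>s. G (y - s *\<^sub>R a)) has_real_derivative G (y - s *\<^sub>R a) * ((y - s *\<^sub>R a) \<bullet> (P *v a))) (at s)"
proof -
  have eq: "(y - s *\<^sub>R a) \<bullet> (P *v (y - s *\<^sub>R a)) = y \<bullet> (P *v y) - 2 * s * (y \<bullet> (P *v a)) + s\<^sup>2 * (a \<bullet> (P *v a))" for s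
    using sym[of a y]
    by (simp add: matrix_vector_mult_diff_distrib inner_diff_left inner_diff_right power2_eq_square
        matrix_vector_mult_scaleR algebra_simps)
  show ?thesis
    unfolding G_def eq
    by (rule derivative_eq_intros refl | simp add: inner_diff_left)+
qed

text \<open>Dominating function for differentiating under the integral. By the mean value bound it
  suffices to control the derivative for all \<open>\<bar>s\<bar> \<le> 1\<close>; the rate
  \<open>m/2\<close> drops to \<open>m/4\<close> for the linear factor and to \<open>m/8\<close> for
  the displacement.\<close>

lemma G_quotient_le:
  obtains B where "B \<ge> 0"
    "\<And>y h. \<bar>h\<bar> \<le> 1 \<Longrightarrow> h \<noteq> 0 \<Longrightarrow> \<bar>(G (y - h *\<^sub>R a) - G y) / h\<bar> \<le> B * exp (- (m/8) * (norm y)\<^sup>2)"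
proof -
  obtain N where N: "N \<ge> 0" "\<And>y. \<bar>y \<bullet> (P *v a)\<bar> \<le> N * (1 + (norm y)\<^sup>2)"
    using inner_P_le[of a] by blast
  define B where "B = N * ((1 + 4/m) * exp ((m/4) * (norm a)\<^sup>2))"
  have B: "B \<ge> 0" using N m_pos by (simp add: B_def)
  have le: "\<bar>G (y - s *\<^sub>R a) * ((y - s *\<^sub>R a) \<bullet> (P *v a))\<bar> \<le> B * exp (- (m/8) * (norm y)\<^sup>2)"
    if s: "\<bar>s\<bar> \<le> 1" for y s
  proof -
    let ?z = "y - s *\<^sub>R a"
    have "\<bar>G ?z * (?z \<bullet> (P *v a))\<bar> \<le> G ?z * (N * (1 + (norm ?z)\<^sup>2))"
      using N(2)[of ?z] by (simp add: abs_mult mult_left_mono)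
    also have "\<dots> = N * ((1 + (norm ?z)\<^sup>2) * G ?z)" by simp
    also have "\<dots> \<le> N * ((1 + 4/m) * exp (- (m/4) * (norm ?z)\<^sup>2))"
      by (intro mult_left_mono G_poly_le N)
    also have "exp (- (m/4) * (norm ?z)\<^sup>2) \<le> exp ((m/4) * (norm (s *\<^sub>R a))\<^sup>2) * exp (- (m/8) * (norm y)\<^sup>2)"
      using exp_sq_shift_le[of "m/4" y "- (s *\<^sub>R a)"] m_pos by simp
    also have "exp ((m/4) * (norm (s *\<^sub>R a))\<^sup>2) \<le> exp ((m/4) * (norm a)\<^sup>2)"
      using s m_pos by (simp add: power_mult_distrib abs_square_le_1 mult_left_le_one_le)
    finally show ?thesis using N m_pos by (simp add: B_def mult_ac mult_left_mono mult_right_mono)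
  qed
  have "\<bar>(G (y - h *\<^sub>R a) - G y) / h\<bar> \<le> B * exp (- (m/8) * (norm y)\<^sup>2)"
    if h: "\<bar>h\<bar> \<le> 1" "h \<noteq> 0" for y h
  proof -
    have "norm (G (y - h *\<^sub>R a) - G (y - 0 *\<^sub>R a)) \<le> B * exp (- (m/8) * (norm y)\<^sup>2) * norm (h - 0)"
    proof (rule field_differentiable_bound[where S="{-1..1}"])
      show "((\<lambda>s. G (y - s *\<^sub>R a)) has_real_derivative G (y - s *\<^sub>R a) * ((y - s *\<^sub>R a) \<bullet> (P *v a)))
          (at s within {-1..1})" for s
        by (rule has_field_derivative_at_within[OF G_line_derivative])
    qed (use h le in auto)
    then show ?thesis using h by (simp add: divide_le_eq)
  qed
  with B show thesis using that by blast
qed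

lemma weighted_integral_line_derivative:
  assumes V: "gauss_bounded V"
  shows "((\<lambda>t. \<integral>x. V x * G (x - w - t *\<^sub>R a) \<partial>lborel) has_real_derivative
      (\<integral>x. V x * (G (x - w) * ((x - w) \<bullet> (P *v a))) \<partial>lborel)) (at 0)"
proof -
  note [measurable] = gauss_bounded_measurable[OF V]
  obtain B where B: "B \<ge> 0"
    "\<And>y h. \<bar>h\<bar> \<le> 1 \<Longrightarrow> h \<noteq> 0 \<Longrightarrow> \<bar>(G (y - h *\<^sub>R a) - G y) / h\<bar> \<le> B * exp (- (m/8) * (norm y)\<^sup>2)"
    using G_quotient_le[of a] by blast
  have int: "integrable lborel (\<lambda>x. V x * G (x - w - t *\<^sub>R a))" for t
    using integrable_gauss_bounded[OF V, of "w + t *\<^sub>R a"] by (simp add: diff_diff_eq)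
  have quot: "((\<integral>x. V x * G (x - w - h *\<^sub>R a) \<partial>lborel) - (\<integral>x. V x * G (x - w - 0 *\<^sub>R a) \<partial>lborel)) / (h - 0)
      = (\<integral>x. V x * ((G (x - w - h *\<^sub>R a) - G (x - w)) / h) \<partial>lborel)" for h
    using int[of h] int[of 0]
    by (simp add: right_diff_distrib flip: Bochner_Integration.integral_diff)
  \<comment> \<open>Restricting \<open>h\<close> to an open interval keeps every sequence within the
    range of the quotient bound. The interval is a neighbourhood of 0, so
    \<open>at_within_open\<close> removes the restriction at the end.\<close>
  have "((\<lambda>h. \<integral>x. V x * ((G (x - w - h *\<^sub>R a) - G (x - w)) / h) \<partial>lborel)
      \<longlongrightarrow> (\<integral>x. V x * (G (x - w) * ((x - w) \<bullet> (P *v a))) \<partial>lborel)) (at 0 within {-1<..<1})"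
    unfolding tendsto_at_iff_sequentially
  proof (intro allI impI)
    fix X :: "nat \<Rightarrow> real"
    assume X: "\<forall>i. X i \<in> {-1<..<1} - {0}" and lim: "X \<longlonglongrightarrow> 0"
    show "((\<lambda>h. \<integral>x. V x * ((G (x - w - h *\<^sub>R a) - G (x - w)) / h) \<partial>lborel) \<circ> X)
      \<longlonglongrightarrow> (\<integral>x. V x * (G (x - w) * ((x - w) \<bullet> (P *v a))) \<partial>lborel)"
      unfolding comp_def
    proof (rule integral_dominated_convergence)
      show "integrable lborel (\<lambda>x. \<bar>V x * (B * exp (- (m/8) * (norm (x - w))\<^sup>2))\<bar>)"
        by (intro integrable_abs gauss_bounded_times[OF V, of _ "m/8" B w]) (use m_pos B(1) in auto)
      show "AE x in lborel. (\<lambda>i. V x * ((G (x - w - X i *\<^sub>R a) - G (x - w)) / X i))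
          \<longlonglongrightarrow> V x * (G (x - w) * ((x - w) \<bullet> (P *v a)))"
      proof (rule AE_I2)
        fix x
        have "((\<lambda>h. (G (x - w - h *\<^sub>R a) - G (x - w)) / h) \<longlongrightarrow> G (x - w) * ((x - w) \<bullet> (P *v a))) (at 0)"
          using G_line_derivative[of "x - w" a 0] by (simp add: has_field_derivative_iff)
        then have "((\<lambda>h. (G (x - w - h *\<^sub>R a) - G (x - w)) / h) \<circ> X) \<longlonglongrightarrow> G (x - w) * ((x - w) \<bullet> (P *v a))"
          using X lim unfolding tendsto_at_iff_sequentially by blast
        then show "(\<lambda>i. V x * ((G (x - w - X i *\<^sub>R a) - G (x - w)) / X i))
            \<longlonglongrightarrow> V x * (G (x - w) * ((x - w) \<bullet> (P *v a)))"
          by (intro tendsto_mult tendsto_const) (simp add: comp_def)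
      qed
      show "AE x in lborel. norm (V x * ((G (x - w - X i *\<^sub>R a) - G (x - w)) / X i))
          \<le> \<bar>V x * (B * exp (- (m/8) * (norm (x - w))\<^sup>2))\<bar>" for i
      proof (rule AE_I2)
        fix x
        have "\<bar>X i\<bar> \<le> 1" "X i \<noteq> 0" using X by (auto simp: abs_le_iff intro: less_imp_le dest: spec[of _ i])
        then have "\<bar>V x\<bar> * \<bar>(G (x - w - X i *\<^sub>R a) - G (x - w)) / X i\<bar>
            \<le> \<bar>V x\<bar> * (B * exp (- (m/8) * (norm (x - w))\<^sup>2))"
          by (intro mult_left_mono B(2)) auto
        then show "norm (V x * ((G (x - w - X i *\<^sub>R a) - G (x - w)) / X i))
            \<le> \<bar>V x * (B * exp (- (m/8) * (norm (x - w))\<^sup>2))\<bar>"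
          using B(1) by (simp only: real_norm_def abs_mult abs_exp_cancel abs_of_nonneg)
      qed
    qed measurable
  qed
  then show ?thesis
    unfolding has_field_derivative_iff quot by (subst (asm) at_within_open) auto
qed

lemma weighted_integral_derivative_linear:
  assumes V: "gauss_bounded V"
  shows "linear (\<lambda>a. \<integral>x. V x * (G (x - w) * ((x - w) \<bullet> (P *v a))) \<partial>lborel)"
proof (rule linearI)
  show "(\<integral>x. V x * (G (x - w) * ((x - w) \<bullet> (P *v (a + b)))) \<partial>lborel)
      = (\<integral>x. V x * (G (x - w) * ((x - w) \<bullet> (P *v a))) \<partial>lborel)
        + (\<integral>x. V x * (G (x - w) * ((x - w) \<bullet> (P *v b))) \<partial>lborel)" for a b
    using integrable_gauss_bounded_inner[OF V]
    by (subst Bochner_Integration.integral_add[symmetric])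
      (simp_all add: matrix_vector_right_distrib inner_add_right distrib_left)
  show "(\<integral>x. V x * (G (x - w) * ((x - w) \<bullet> (P *v (r *\<^sub>R a)))) \<partial>lborel)
      = r *\<^sub>R (\<integral>x. V x * (G (x - w) * ((x - w) \<bullet> (P *v a))) \<partial>lborel)" for r a
    by (simp add: matrix_vector_mult_scaleR mult_ac)
qed

end

section \<open>SR matrix and energy of the Gaussian wavefunction\<close>

text \<open>For real \<open>v\<close> the quadratic form is the expectation of the squared modulus
  of \<open>u\<close>, the combination of the centred log-derivatives with coefficients
  \<open>v\<close>. Integrability lets the integral pass through the double sum.\<close>

lemma SR_matrix_psd:
  assumes int: "\<And>j k. integrable (born_measure \<nu> (\<psi> \<theta>))
    (\<lambda>x. centered_grad_log \<nu> \<psi> \<theta> x $ j * cnj (centered_grad_log \<nu> \<psi> \<theta> x $ k))"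
  shows "0 \<le> v \<bullet> (SR_matrix \<nu> \<psi> \<theta> *v v)"
proof -
  define D where "D = centered_grad_log \<nu> \<psi> \<theta>"
  define \<mu> where "\<mu> = born_measure \<nu> (\<psi> \<theta>)"
  note int' = int[folded D_def \<mu>_def]
  define u where "u x = (\<Sum>j\<in>UNIV. of_real (v $ j) * D x $ j)" for x
  have uu: "u x * cnj (u x) = (\<Sum>j\<in>UNIV. \<Sum>k\<in>UNIV. of_real (v $ j * v $ k) * (D x $ j * cnj (D x $ k)))" for x
    by (simp add: u_def sum_product mult_ac)
  have "v \<bullet> (SR_matrix \<nu> \<psi> \<theta> *v v)
      = (\<Sum>j\<in>UNIV. \<Sum>k\<in>UNIV. Re (of_real (v $ j * v $ k) * (\<integral>x. D x $ j * cnj (D x $ k) \<partial>\<mu>)))"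
    by (simp add: inner_vec_def matrix_vector_mult_def SR_matrix_def sum_distrib_left mult_ac
        flip: D_def \<mu>_def)
  also have "\<dots> = Re (\<Sum>j\<in>UNIV. \<Sum>k\<in>UNIV. \<integral>x. of_real (v $ j * v $ k) * (D x $ j * cnj (D x $ k)) \<partial>\<mu>)"
    by simp
  also have "(\<Sum>j\<in>UNIV. \<Sum>k\<in>UNIV. \<integral>x. of_real (v $ j * v $ k) * (D x $ j * cnj (D x $ k)) \<partial>\<mu>)
      = (\<integral>x. u x * cnj (u x) \<partial>\<mu>)"
    unfolding uu
    by (subst Bochner_Integration.integral_sum
        | intro Bochner_Integration.integrable_sum integrable_mult_right int' sum.cong refl)+
  also have "\<dots> = (\<integral>x. complex_of_real ((cmod (u x))\<^sup>2) \<partial>\<mu>)"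
    by (simp only: complex_norm_square)
  also have "\<dots> = of_real (\<integral>x. (cmod (u x))\<^sup>2 \<partial>\<mu>)" by (rule integral_complex_of_real)
  finally show ?thesis by simp
qed

text \<open>Positivity passes to the inverse by writing \<open>y = \<Sigma> *v (P *v y)\<close>. The
  constant \<open>m\<close> is the minimum of the form on the unit sphere, attained by compactness;
  homogeneity extends the bound to all vectors.\<close>

lemma symmetric_pos_def_inv:
  fixes \<Sigma> :: "real^'d^'d"
  assumes \<Sigma>: "symmetric_pos_def \<Sigma>"
  obtains m where "gaussian_weight (matrix_inv \<Sigma>) m"
proof -
  define P where "P = matrix_inv \<Sigma>"
  have sym: "(\<Sigma> *v x) \<bullet> y = x \<bullet> (\<Sigma> *v y)" for x y
    using \<Sigma> dot_lmul_matrix[of x \<Sigma> y] transpose_matrix_vector[of \<Sigma> x] by (simp add: symmetric_pos_def_def)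
  have "x = 0" if "\<Sigma> *v x = 0" for x
    using \<Sigma> that by (auto simp: symmetric_pos_def_def dest!: spec[of _ x])
  then have "\<exists>N. N ** \<Sigma> = mat 1" by (subst matrix_left_invertible_ker) blast
  then have "invertible \<Sigma>" by (simp add: invertible_left_inverse)
  from matrix_inv_inverse[OF this] have \<Sigma>P: "\<Sigma> *v (P *v y) = y" for y
    by (simp add: P_def matrix_vector_mul_assoc)
  have symP: "x \<bullet> (P *v y) = y \<bullet> (P *v x)" for x y
    using sym[of "P *v x" "P *v y"] by (simp add: \<Sigma>P inner_commute)
  have pos: "0 < y \<bullet> (P *v y)" if "y \<noteq> 0" for y
  proof -
    have "P *v y \<noteq> 0" using \<Sigma>P[of y] that by auto
    then have "0 < (P *v y) \<bullet> (\<Sigma> *v (P *v y))" using \<Sigma> by (auto simp: symmetric_pos_def_def)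
    then show ?thesis by (simp add: \<Sigma>P inner_commute)
  qed
  have "\<exists>z\<in>sphere 0 1. \<forall>y\<in>sphere (0::real^'d) 1. z \<bullet> (P *v z) \<le> y \<bullet> (P *v y)"
    by (rule continuous_attains_inf)
      (auto intro!: continuous_intros matrix_vector_mult_linear_continuous_on)
  then obtain z where z: "norm z = 1" "\<And>y. norm y = 1 \<Longrightarrow> z \<bullet> (P *v z) \<le> y \<bullet> (P *v y)"
    by auto
  have "z \<bullet> (P *v z) * (norm y)\<^sup>2 \<le> y \<bullet> (P *v y)" for y
  proof (cases "y = 0")
    case False
    have "y \<bullet> (P *v y) = ((1 / norm y) *\<^sub>R y) \<bullet> (P *v ((1 / norm y) *\<^sub>R y)) * (norm y)\<^sup>2"
      using False by (simp add: matrix_vector_mult_scaleR power2_eq_square)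
    also have "\<dots> \<ge> z \<bullet> (P *v z) * (norm y)\<^sup>2"
      using False by (intro mult_right_mono z(2)) auto
    finally show ?thesis .
  qed simp
  moreover have "0 < z \<bullet> (P *v z)" using z(1) by (intro pos) auto
  ultimately have "gaussian_weight P (z \<bullet> (P *v z))"
    using symP by unfold_locales auto
  then show thesis unfolding P_def by (rule that)
qed

section \<open>Position derivatives of the Gaussian wavefunction\<close>

context gaussian_weight
begin

definition H :: "real^'d \<Rightarrow> real"
  where "H y = exp (- (1/4) * (y \<bullet> (P *v y)))"

lemma H_pos: "0 < H y"
  by (simp add: H_def)

lemma H_sq: "H y * H y = G y"
  by (simp add: H_def G_def flip: exp_add)

lemma H_line_derivative:
  "((\<lambda>s. H (y + s *\<^sub>R a)) has_real_derivative - H (y + s *\<^sub>R a) * ((y + s *\<^sub>R a) \<bullet> (P *v a)) / 2) (at s)"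
proof -
  have eq: "(y + s *\<^sub>R a) \<bullet> (P *v (y + s *\<^sub>R a)) = y \<bullet> (P *v y) + 2 * s * (y \<bullet> (P *v a)) + s\<^sup>2 * (a \<bullet> (P *v a))" for s
    using sym[of a y]
    by (simp add: matrix_vector_right_distrib inner_add_left inner_add_right power2_eq_square
        matrix_vector_mult_scaleR algebra_simps)
  show ?thesis
    unfolding H_def eq
    by (rule derivative_eq_intros refl | simp add: inner_add_left)+
qed

lemma partial_deriv_H:
  "partial_deriv p (\<lambda>x. complex_of_real (H (x - w))) x
    = of_real (- H (x - w) * ((x - w) \<bullet> (P *v axis p 1)) / 2)"
  unfolding partial_deriv_def
proof (rule vector_derivative_at)
  show "((\<lambda>t. complex_of_real (H (x + t *\<^sub>R axis p 1 - w)))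
      has_vector_derivative of_real (- H (x - w) * ((x - w) \<bullet> (P *v axis p 1)) / 2)) (at 0)"
    using H_line_derivative[of "x - w" "axis p 1" 0]
    by (intro bounded_linear.has_vector_derivative[OF bounded_linear_of_real])
      (simp add: has_real_derivative_iff_has_vector_derivative algebra_simps)
qed

lemma partial_deriv_partial_deriv_H:
  "partial_deriv p (partial_deriv p (\<lambda>x. complex_of_real (H (x - w)))) x
    = of_real (H (x - w) * (((x - w) \<bullet> (P *v axis p 1))\<^sup>2 / 4 - axis p 1 \<bullet> (P *v axis p 1) / 2))"
proof -
  let ?e = "axis p 1"
  have "((\<lambda>t. - H (x - w + t *\<^sub>R ?e) * ((x - w + t *\<^sub>R ?e) \<bullet> (P *v ?e)) / 2) has_real_derivative
      H (x - w) * (((x - w) \<bullet> (P *v ?e))\<^sup>2 / 4 - ?e \<bullet> (P *v ?e) / 2)) (at 0)"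
    unfolding inner_add_left inner_scaleR_left
    by (rule derivative_eq_intros H_line_derivative refl | simp)+ (simp add: power2_eq_square algebra_simps)
  then have "((\<lambda>t. complex_of_real (- H (x - w + t *\<^sub>R ?e) * ((x - w + t *\<^sub>R ?e) \<bullet> (P *v ?e)) / 2)) has_vector_derivative
      of_real (H (x - w) * (((x - w) \<bullet> (P *v ?e))\<^sup>2 / 4 - ?e \<bullet> (P *v ?e) / 2))) (at 0)"
    by (intro bounded_linear.has_vector_derivative[OF bounded_linear_of_real])
      (simp add: has_real_derivative_iff_has_vector_derivative)
  then show ?thesis
    unfolding partial_deriv_def[of p "partial_deriv p _"] partial_deriv_H
    by (intro vector_derivative_at) (simp add: algebra_simps)
qed

lemma integral_G_shift: "(\<integral>x. G (x - w) \<partial>lborel) = (\<integral>x. G x \<partial>lborel)"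
  by (rule integral_lborel_shift) simp

end

section \<open>Log-derivatives and SR matrix in the frame moving with the Gaussian\<close>

context gaussian_weight
begin

text \<open>Log-derivative in the parameter, as a function of the displacement from the centre;
  differentiating the quadratic form doubles 1/4 to 1/2.\<close>

definition score :: "real^'p^'d \<Rightarrow> real^'d \<Rightarrow> complex^'p"
  where "score A y = (\<chi> j. of_real (y \<bullet> (P *v (A *v axis j 1)) / 2))"

lemma score_measurable [measurable]: "score A \<in> borel_measurable borel"
  unfolding score_def by (intro borel_measurable_continuous_onI continuous_on_vec_lambda continuous_intros) auto

lemma grad_log_H: "grad_log (\<lambda>\<theta> x. complex_of_real (H (x - A *v \<theta>))) \<theta> x = score A (x - A *v \<theta>)"
proof -
  have "partial_deriv j (\<lambda>\<theta>. complex_of_real (H (x - A *v \<theta>))) \<theta>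
      = of_real (H (x - A *v \<theta>) * ((x - A *v \<theta>) \<bullet> (P *v (A *v axis j 1))) / 2)" for j
    unfolding partial_deriv_def
  proof (rule vector_derivative_at)
    show "((\<lambda>t. complex_of_real (H (x - A *v (\<theta> + t *\<^sub>R axis j 1)))) has_vector_derivative
        of_real (H (x - A *v \<theta>) * ((x - A *v \<theta>) \<bullet> (P *v (A *v axis j 1))) / 2)) (at 0)"
      using H_line_derivative[of "x - A *v \<theta>" "- (A *v axis j 1)" 0]
      by (intro bounded_linear.has_vector_derivative[OF bounded_linear_of_real])
        (simp add: has_real_derivative_iff_has_vector_derivative matrix_vector_right_distrib
          matrix_vector_mult_scaleR linear_neg[OF matrix_vector_mul_linear] diff_diff_eq)
  qed
  then show ?thesis
    using H_pos[of "x - A *v \<theta>"] by (simp add: grad_log_def grad_def score_def vec_eq_iff)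
qed

lemma born_measure_H:
  "born_measure lborel (\<lambda>x. complex_of_real (H (x - w)))
    = density lborel (\<lambda>x. ennreal (G (x - w) / (\<integral>y. G y \<partial>lborel)))"
  using H_pos by (simp add: born_measure_def power2_eq_square H_sq integral_G_shift less_imp_le)

lemma integral_born_H:
  fixes f :: "real^'d \<Rightarrow> 'b::{banach, second_countable_topology}"
  assumes [measurable]: "f \<in> borel_measurable borel"
  shows "(\<integral>x. f (x - w) \<partial>density lborel (\<lambda>x. ennreal (G (x - w) / (\<integral>y. G y \<partial>lborel))))
    = (\<integral>y. (G y / (\<integral>y. G y \<partial>lborel)) *\<^sub>R f y \<partial>lborel)"
proof -
  have "(\<integral>x. f (x - w) \<partial>density lborel (\<lambda>x. ennreal (G (x - w) / (\<integral>y. G y \<partial>lborel))))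
    = (\<integral>x. (G (x - w) / (\<integral>y. G y \<partial>lborel)) *\<^sub>R f (x - w) \<partial>lborel)"
    by (rule integral_density) (auto intro!: AE_I2 divide_nonneg_nonneg integral_nonneg_AE)
  also have "\<dots> = (\<integral>y. (G y / (\<integral>y. G y \<partial>lborel)) *\<^sub>R f y \<partial>lborel)"
    by (rule integral_lborel_shift[where f="\<lambda>y. (G y / (\<integral>y. G y \<partial>lborel)) *\<^sub>R f y"]) simp
  finally show ?thesis .
qed

text \<open>Seen from the centre \<open>A *v \<theta>\<close>, Born density and log-derivatives are
  fixed functions, so the substitution \<open>y = x - A *v \<theta>\<close> removes the parameter
  from every entry.\<close>

lemma SR_matrix_H:
  fixes A :: "real^'p^'d"
  defines "\<psi> \<equiv> \<lambda>\<theta> x. complex_of_real (H (x - A *v \<theta>))"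
  obtains S0 where "\<And>\<theta>. SR_matrix lborel \<psi> \<theta> = S0" "\<And>v. 0 \<le> v \<bullet> (S0 *v v)"
proof -
  let ?Z = "\<integral>y. G y \<partial>lborel"
  define m0 where "m0 = (\<integral>y. (G y / ?Z) *\<^sub>R score A y \<partial>lborel)"
  define b where "b y = score A y - m0" for y
  have b_measurable [measurable]: "b \<in> borel_measurable borel" unfolding b_def by measurable
  have bb_measurable [measurable]: "(\<lambda>y. b y $ j * cnj (b y $ k)) \<in> borel_measurable borel" for j k
    by (rule measurable_compose[OF b_measurable borel_measurable_continuous_onI[where f="\<lambda>v. v $ j * cnj (v $ k)"]])
      (intro continuous_intros)
  have born: "born_measure lborel (\<psi> \<theta>) = density lborel (\<lambda>x. ennreal (G (x - A *v \<theta>) / ?Z))" for \<theta>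
    unfolding \<psi>_def by (rule born_measure_H)
  have centered: "centered_grad_log lborel \<psi> \<theta> x = b (x - A *v \<theta>)" for \<theta> x
    unfolding centered_grad_log_def born unfolding \<psi>_def grad_log_H b_def m0_def
    by (subst integral_born_H) auto
  have SR: "SR_matrix lborel \<psi> \<theta> = (\<chi> j k. Re (\<integral>y. (G y / ?Z) *\<^sub>R (b y $ j * cnj (b y $ k)) \<partial>lborel))" for \<theta>
    unfolding SR_matrix_def born centered
    by (subst integral_born_H[where f="\<lambda>y. b y $ _ * cnj (b y $ _)"]) auto
  \<comment> \<open>Linear growth of each component makes products of two components grow
    quadratically, which \<open>integrable_poly\<close> admits.\<close>
  have bj_le: "\<exists>C\<ge>0. \<forall>y. cmod (b y $ j) \<le> C * (1 + norm y)" for j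
  proof (intro exI conjI allI)
    let ?a = "P *v (A *v axis j 1)"
    fix y
    have "cmod (b y $ j) \<le> cmod (of_real (y \<bullet> ?a / 2)) + cmod (m0 $ j)"
      unfolding b_def score_def vector_minus_component vec_lambda_beta by (rule norm_triangle_ineq4)
    also have "cmod (of_real (y \<bullet> ?a / 2)) \<le> norm ?a * norm y"
      using Cauchy_Schwarz_ineq2[of y ?a] unfolding norm_of_real abs_divide
      by (simp add: mult.commute)
    also have "norm ?a * norm y + cmod (m0 $ j) \<le> (norm ?a + cmod (m0 $ j)) * (1 + norm y)"
      by (simp add: algebra_simps)
    finally show "cmod (b y $ j) \<le> (norm ?a + cmod (m0 $ j)) * (1 + norm y)" by simp
  qed simp
  have int: "integrable (density lborel (\<lambda>x. ennreal (G (x - w) / ?Z))) (\<lambda>x. b (x - w) $ j * cnj (b (x - w) $ k))"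
    for w j k
  proof -
    obtain C D where C: "C \<ge> 0" "\<And>y. cmod (b y $ j) \<le> C * (1 + norm y)"
      and D: "D \<ge> 0" "\<And>y. cmod (b y $ k) \<le> D * (1 + norm y)"
      using bj_le by metis
    have "norm (b y $ j * cnj (b y $ k)) \<le> 2 * C * D * (1 + (norm y)\<^sup>2)" for y
    proof -
      have "norm (b y $ j * cnj (b y $ k)) \<le> (C * (1 + norm y)) * (D * (1 + norm y))"
        unfolding norm_mult complex_mod_cnj using C D by (intro mult_mono) auto
      also have "\<dots> = C * D * (1 + norm y)\<^sup>2" by (simp add: power2_eq_square)
      also have "\<dots> \<le> C * D * (2 * (1 + (norm y)\<^sup>2))"
        using sum_squares_bound[of 1 "norm y"] C D by (intro mult_left_mono) (auto simp: power2_sum)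
      finally show ?thesis by (simp only: mult_ac)
    qed
    then have "integrable lborel (\<lambda>x. G (x - w) *\<^sub>R (b (x - w) $ j * cnj (b (x - w) $ k)))"
      by (intro integrable_poly[where f="\<lambda>y. b y $ j * cnj (b y $ k)"]) auto
    then have "integrable lborel (\<lambda>x. (1 / ?Z) *\<^sub>R (G (x - w) *\<^sub>R (b (x - w) $ j * cnj (b (x - w) $ k))))"
      by (rule integrable_scaleR_right)
    then show ?thesis
      by (subst integrable_density) (auto intro!: AE_I2 divide_nonneg_nonneg integral_nonneg_AE)
  qed
  show thesis
  proof
    fix \<theta> show "SR_matrix lborel \<psi> \<theta> = SR_matrix lborel \<psi> 0" by (simp only: SR)
  next
    fix v show "0 \<le> v \<bullet> (SR_matrix lborel \<psi> 0 *v v)"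
      by (rule SR_matrix_psd) (simp only: centered born int)
  qed
qed

end

text \<open>The Laplacian multiplies \<open>H\<close> by a quadratic polynomial in
  \<open>x - A *v \<theta>\<close>, so the kinetic density is a translate of one fixed function and
  integrates to the constant \<open>k0\<close>. The potential does not move with the centre and
  carries all dependence on the parameter.\<close>

lemma energy_gaussian:
  fixes P :: "real^('n::{finite,linorder} \<times> 3)^('n \<times> 3)" and A :: "real^'p^('n \<times> 3)"
  assumes "gaussian_weight P m"
  defines "\<psi> \<equiv> \<lambda>\<theta> x. complex_of_real (gaussian_weight.H P (x - A *v \<theta>))"
  obtains k0 where "\<And>\<theta>. energy lborel (electronic_hamiltonian M Z R) \<psi> \<theta>
    = (k0 + (\<integral>x. coulomb_potential M Z R x * gaussian_weight.G P (x - A *v \<theta>) \<partial>lborel))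
      / (\<integral>x. gaussian_weight.G P x \<partial>lborel)"
proof -
  interpret gaussian_weight P m by fact
  let ?V = "coulomb_potential M Z R :: real^('n \<times> 3) \<Rightarrow> real"
  have V: "gauss_bounded ?V" by (rule gauss_bounded_coulomb_potential)
  \<comment> \<open>\<open>q p\<close> is the second derivative of \<open>H\<close> in coordinate
    \<open>p\<close> divided by \<open>H\<close>; \<open>kin\<close> is the local kinetic
    energy.\<close>
  define q where "q p y = (y \<bullet> (P *v axis p 1))\<^sup>2 / 4 - axis p 1 \<bullet> (P *v axis p 1) / 2" for p y
  define kin where "kin y = - (1/2) * (\<Sum>i\<in>UNIV. \<Sum>c\<in>UNIV. q (i, c) y)" for y
  have q_measurable [measurable]: "q p \<in> borel_measurable borel" for p
    unfolding q_def by measurable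
  have kin_measurable [measurable]: "kin \<in> borel_measurable borel"
    unfolding kin_def by measurable
  have q_le: "\<bar>q p y\<bar> \<le> ((norm (P *v axis p 1))\<^sup>2 + \<bar>axis p 1 \<bullet> (P *v axis p 1)\<bar>) * (1 + (norm y)\<^sup>2)" for p y
  proof -
    let ?a = "P *v axis p 1"
    have "(y \<bullet> ?a)\<^sup>2 \<le> (norm y * norm ?a)\<^sup>2"
      using Cauchy_Schwarz_ineq2[of y ?a] by (subst abs_le_square_iff[symmetric]) simp
    then have 1: "(y \<bullet> ?a)\<^sup>2 \<le> (norm ?a)\<^sup>2 * (norm y)\<^sup>2" by (simp add: power_mult_distrib mult.commute)
    have "\<bar>q p y\<bar> \<le> (y \<bullet> ?a)\<^sup>2 / 4 + \<bar>axis p 1 \<bullet> ?a\<bar> / 2"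
      unfolding q_def by (rule order_trans[OF abs_triangle_ineq4]) simp
    also have "\<dots> \<le> (norm ?a)\<^sup>2 * (norm y)\<^sup>2 + \<bar>axis p 1 \<bullet> ?a\<bar>"
      using 1 zero_le_power2[of "y \<bullet> ?a"] abs_ge_zero[of "axis p 1 \<bullet> ?a"] by linarith
    also have "\<dots> \<le> ((norm ?a)\<^sup>2 + \<bar>axis p 1 \<bullet> ?a\<bar>) * (1 + (norm y)\<^sup>2)"
      by (simp add: algebra_simps)
    finally show ?thesis .
  qed
  have kin_le: "norm (kin y) \<le> (\<Sum>i\<in>UNIV. \<Sum>c\<in>UNIV. (norm (P *v axis (i, c) 1))\<^sup>2
      + \<bar>axis (i, c) 1 \<bullet> (P *v axis (i, c) 1)\<bar>) * (1 + (norm y)\<^sup>2)" for y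
  proof -
    have "norm (kin y) \<le> \<bar>\<Sum>i\<in>UNIV. \<Sum>c\<in>UNIV. q (i, c) y\<bar>"
      by (simp add: kin_def abs_mult)
    also have "\<dots> \<le> (\<Sum>i\<in>UNIV. \<Sum>c\<in>UNIV. \<bar>q (i, c) y\<bar>)"
      by (intro order_trans[OF sum_abs] sum_mono sum_abs)
    also have "\<dots> \<le> (\<Sum>i\<in>UNIV. \<Sum>c\<in>UNIV. ((norm (P *v axis (i, c) 1))\<^sup>2
      + \<bar>axis (i, c) 1 \<bullet> (P *v axis (i, c) 1)\<bar>) * (1 + (norm y)\<^sup>2))"
      by (intro sum_mono q_le)
    finally show ?thesis by (simp only: sum_distrib_right)
  qed
  have ham: "cnj (\<psi> \<theta> x) * electronic_hamiltonian M Z R (\<psi> \<theta>) x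
      = of_real (G (x - A *v \<theta>) *\<^sub>R kin (x - A *v \<theta>) + ?V x * G (x - A *v \<theta>))" for \<theta> x
  proof -
    let ?y = "x - A *v \<theta>"
    have "laplacian_at i (\<psi> \<theta>) x = of_real (H ?y * (\<Sum>c\<in>UNIV. q (i, c) ?y))" for i
      by (simp add: laplacian_at_def \<psi>_def partial_deriv_partial_deriv_H q_def sum_distrib_left)
    then have "electronic_hamiltonian M Z R (\<psi> \<theta>) x = of_real (H ?y * (kin ?y + ?V x))"
      by (simp add: electronic_hamiltonian_def kin_def \<psi>_def sum_distrib_left[symmetric] algebra_simps
          flip: of_real_sum)
    then show ?thesis
      unfolding H_sq[symmetric] by (simp add: \<psi>_def algebra_simps)
  qed
  have norm_sq: "cnj (\<psi> \<theta> x) * \<psi> \<theta> x = of_real (G (x - A *v \<theta>))" for \<theta> x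
    unfolding H_sq[symmetric] by (simp add: \<psi>_def)
  show thesis
  proof
    fix \<theta>
    have "(\<integral>x. G (x - A *v \<theta>) *\<^sub>R kin (x - A *v \<theta>) + ?V x * G (x - A *v \<theta>) \<partial>lborel)
        = (\<integral>x. G (x - A *v \<theta>) *\<^sub>R kin (x - A *v \<theta>) \<partial>lborel) + (\<integral>x. ?V x * G (x - A *v \<theta>) \<partial>lborel)"
      by (intro Bochner_Integration.integral_add integrable_poly[OF kin_measurable kin_le] integrable_gauss_bounded V)
    also have "(\<integral>x. G (x - A *v \<theta>) *\<^sub>R kin (x - A *v \<theta>) \<partial>lborel) = (\<integral>y. G y *\<^sub>R kin y \<partial>lborel)"
      by (rule integral_lborel_shift[where f="\<lambda>y. G y *\<^sub>R kin y"]) simp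
    finally show "energy lborel (electronic_hamiltonian M Z R) \<psi> \<theta>
      = ((\<integral>y. G y *\<^sub>R kin y \<partial>lborel) + (\<integral>x. ?V x * G (x - A *v \<theta>) \<partial>lborel)) / (\<integral>x. G x \<partial>lborel)"
      unfolding energy_def braket_def ham norm_sq integral_complex_of_real integral_G_shift
      by (simp flip: of_real_divide)
  qed
qed

section \<open>SR matrix and energy of the phase wavefunction\<close>

lemma finite_spin_configs: "finite (spin_configs :: (real^'n) set)"
proof (rule finite_subset)
  show "spin_configs \<subseteq> vec_lambda ` (UNIV \<rightarrow>\<^sub>E {-1, 1 :: real} :: ('n \<Rightarrow> real) set)"
  proof
    fix x :: "real^'n" assume "x \<in> spin_configs"
    then show "x \<in> vec_lambda ` (UNIV \<rightarrow>\<^sub>E {-1, 1 :: real})"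
      by (intro image_eqI[of _ _ "vec_nth x"]) (auto simp: spin_configs_def)
  qed
qed (intro finite_imageI finite_PiE, auto)

lemma phase_wf_nonzero: "phase_wf B \<theta> x \<noteq> 0"
  by (simp add: phase_wf_def)

lemma cnj_phase_wf_times:
  fixes B :: "real^'p^'n"
  shows "cnj (phase_wf B \<theta> x) * phase_wf B \<theta> y
    = of_real ((2 powr (- real CARD('n) / 2))\<^sup>2) * cis ((y - x) \<bullet> (B *v \<theta>))"
  by (simp add: phase_wf_def cis_cnj cis_mult inner_diff_left power2_eq_square mult_ac flip: cis_conv_exp)

lemma cmod_phase_wf:
  fixes B :: "real^'p^'n"
  shows "cmod (phase_wf B \<theta> x) = 2 powr (- real CARD('n) / 2)"
  by (simp add: phase_wf_def norm_mult)

text \<open>The phase is linear in the parameter and the modulus constant, so the log-derivative is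
  imaginary and free of \<open>\<theta>\<close>.\<close>

lemma grad_log_phase_wf: "grad_log (phase_wf B) \<theta> x = (\<chi> j. \<i> * of_real (x \<bullet> (B *v axis j 1)))"
proof -
  have "partial_deriv j (\<lambda>\<theta>. phase_wf B \<theta> x) \<theta> = phase_wf B \<theta> x * (\<i> * of_real (x \<bullet> (B *v axis j 1)))" for j
    unfolding partial_deriv_def
  proof (rule vector_derivative_at)
    \<comment> \<open>A complex variable \<open>z\<close> replaces the real step so that complex
      derivative rules apply; restricting to the real line gives the vector derivative.\<close>
    let ?f = "\<lambda>z. of_real (2 powr (- real CARD('b) / 2)) * exp (\<i> * (of_real (x \<bullet> (B *v \<theta>)) + z * of_real (x \<bullet> (B *v axis j 1))))"
    have "(?f has_field_derivative phase_wf B \<theta> x * (\<i> * of_real (x \<bullet> (B *v axis j 1)))) (at (of_real 0))"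
      unfolding phase_wf_def by (rule derivative_eq_intros refl | simp)+
    from has_vector_derivative_real_field[OF this]
    show "((\<lambda>t. phase_wf B (\<theta> + t *\<^sub>R axis j 1) x)
        has_vector_derivative phase_wf B \<theta> x * (\<i> * of_real (x \<bullet> (B *v axis j 1)))) (at 0)"
      by (simp add: phase_wf_def matrix_vector_right_distrib matrix_vector_mult_scaleR inner_add_right)
  qed
  then show ?thesis
    by (simp add: grad_log_def grad_def vec_eq_iff phase_wf_nonzero)
qed

text \<open>The constant modulus makes the Born measure the same uniform measure for every
  parameter, and the log-derivatives do not depend on it either.\<close>

lemma SR_matrix_phase_wf:
  fixes B :: "real^'p^'n"
  obtains S0 where "\<And>\<theta>. SR_matrix (count_space spin_configs) (phase_wf B) \<theta> = S0" "\<And>v. 0 \<le> v \<bullet> (S0 *v v)"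
proof
  fix \<theta>
  show "SR_matrix (count_space spin_configs) (phase_wf B) \<theta> = SR_matrix (count_space spin_configs) (phase_wf B) 0"
    by (simp add: SR_matrix_def centered_grad_log_def grad_log_phase_wf born_measure_def cmod_phase_wf)
next
  fix v :: "real^'p"
  show "0 \<le> v \<bullet> (SR_matrix (count_space spin_configs) (phase_wf B) 0 *v v)"
    by (rule SR_matrix_psd)
      (simp add: born_measure_def integrable_density integrable_count_space finite_spin_configs integral_nonneg_AE)
qed

text \<open>Only relative phases survive, so the energy is a finite trigonometric sum in the
  parameter; the constant norm of the wavefunction is absorbed into the coefficients
  \<open>k\<close>.\<close>

lemma energy_phase_wf:
  fixes B :: "real^'p^'n"
  obtains k where "\<And>\<theta>. energy (count_space spin_configs) (spin_hamiltonian h) (phase_wf B) \<theta>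
    = (\<Sum>x\<in>spin_configs. \<Sum>y\<in>spin_configs. Re (k x y * cis ((y - x) \<bullet> (B *v \<theta>))))"
proof
  fix \<theta>
  let ?c = "complex_of_real ((2 powr (- real CARD('n) / 2))\<^sup>2)"
  let ?D = "\<Sum>x\<in>(spin_configs :: (real^'n) set). ?c"
  have 1: "braket (count_space spin_configs) (phase_wf B \<theta>) (spin_hamiltonian h (phase_wf B \<theta>))
      = (\<Sum>x\<in>spin_configs. \<Sum>y\<in>spin_configs. h x y * (cnj (phase_wf B \<theta> x) * phase_wf B \<theta> y))"
    by (simp add: braket_def lebesgue_integral_count_space_finite finite_spin_configs spin_hamiltonian_def
        sum_distrib_left mult_ac)
  have 2: "braket (count_space spin_configs) (phase_wf B \<theta>) (phase_wf B \<theta>) = ?D"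
    unfolding braket_def cnj_phase_wf_times
    by (subst lebesgue_integral_count_space_finite) (simp_all add: finite_spin_configs)
  show "energy (count_space spin_configs) (spin_hamiltonian h) (phase_wf B) \<theta>
    = (\<Sum>x\<in>spin_configs. \<Sum>y\<in>spin_configs. Re (h x y * ?c / ?D * cis ((y - x) \<bullet> (B *v \<theta>))))"
    unfolding energy_def 1 2 cnj_phase_wf_times
    by (simp only: sum_divide_distrib Re_sum times_divide_eq_left mult.assoc)
qed

section \<open>Regularity of the energy\<close>

text \<open>The parameter enters only through the centre \<open>A *v \<theta>\<close>: the
  derivative in direction \<open>v\<close> is that of the convolution in direction
  \<open>A *v v\<close>, and linearity survives the composition, as \<open>grad_eqI\<close>
  requires.\<close>

lemma energy_gaussian_regular:
  fixes P :: "real^('n::{finite,linorder} \<times> 3)^('n \<times> 3)" and A :: "real^'p^('n \<times> 3)"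
    and M :: nat and Z :: "nat \<Rightarrow> nat" and R :: "nat \<Rightarrow> real^3"
  assumes "gaussian_weight P m"
  defines "L \<equiv> energy lborel (electronic_hamiltonian M Z R) (\<lambda>\<theta> x. complex_of_real (gaussian_weight.H P (x - A *v \<theta>)))"
  shows "\<exists>b. \<forall>\<theta>. b \<le> L \<theta>"
    and "((\<lambda>t. L (\<theta> + t *\<^sub>R v)) has_real_derivative grad L \<theta> \<bullet> v) (at 0)"
proof -
  interpret gaussian_weight P m by fact
  let ?V = "coulomb_potential M Z R :: real^('n \<times> 3) \<Rightarrow> real"
  let ?Z = "\<integral>x. G x \<partial>lborel"
  have V: "gauss_bounded ?V" by (rule gauss_bounded_coulomb_potential)
  obtain k0 where k0: "\<And>\<theta>. L \<theta> = (k0 + (\<integral>x. ?V x * G (x - A *v \<theta>) \<partial>lborel)) / ?Z"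
    unfolding L_def using energy_gaussian[OF assms(1)] by blast
  have Z: "0 \<le> ?Z" by (intro integral_nonneg_AE AE_I2) simp
  obtain K where K: "\<And>w. \<bar>\<integral>x. ?V x * G (x - w) \<partial>lborel\<bar> \<le> K"
    using weighted_integral_bounded[OF V] by blast
  have "(k0 - K) / ?Z \<le> L \<theta>" for \<theta>
    unfolding k0 using K[of "A *v \<theta>"] Z by (intro divide_right_mono) auto
  then show "\<exists>b. \<forall>\<theta>. b \<le> L \<theta>" by blast
  define d where "d \<theta> v = (\<integral>x. ?V x * (G (x - A *v \<theta>) * ((x - A *v \<theta>) \<bullet> (P *v (A *v v)))) \<partial>lborel) / ?Z" for \<theta> v
  have "linear (\<lambda>v. (1 / ?Z) *\<^sub>R (\<integral>x. ?V x * (G (x - A *v \<theta>) * ((x - A *v \<theta>) \<bullet> (P *v (A *v v)))) \<partial>lborel))" for \<theta>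
    using linear_compose[OF matrix_vector_mul_linear weighted_integral_derivative_linear[OF V]]
    by (intro linear_compose_scale_right) (simp add: comp_def)
  then have lin: "linear (d \<theta>)" for \<theta> by (simp add: d_def[abs_def])
  have deriv: "((\<lambda>t. L (\<theta> + t *\<^sub>R v)) has_real_derivative d \<theta> v) (at 0)" for \<theta> v
    unfolding k0 d_def matrix_vector_right_distrib matrix_vector_mult_scaleR diff_diff_eq[symmetric]
    by (rule DERIV_cdivide) (auto intro!: derivative_eq_intros weighted_integral_line_derivative[OF V])
  show "((\<lambda>t. L (\<theta> + t *\<^sub>R v)) has_real_derivative grad L \<theta> \<bullet> v) (at 0)"
    unfolding grad_eqI[OF deriv lin] by (rule deriv)
qed

lemma energy_phase_wf_regular:
  fixes B :: "real^'p^'n" and h :: "real^'n \<Rightarrow> real^'n \<Rightarrow> complex"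
  defines "L \<equiv> energy (count_space spin_configs) (spin_hamiltonian h) (phase_wf B)"
  shows "\<exists>b. \<forall>\<theta>. b \<le> L \<theta>"
    and "((\<lambda>t. L (\<theta> + t *\<^sub>R v)) has_real_derivative grad L \<theta> \<bullet> v) (at 0)"
proof -
  obtain k where k: "\<And>\<theta>. L \<theta> = (\<Sum>x\<in>spin_configs. \<Sum>y\<in>spin_configs. Re (k x y * cis ((y - x) \<bullet> (B *v \<theta>))))"
    unfolding L_def using energy_phase_wf by blast
  have "(\<Sum>x\<in>spin_configs. \<Sum>y\<in>spin_configs. - cmod (k x y)) \<le> L \<theta>" for \<theta>
    unfolding k
  proof (intro sum_mono)
    show "- cmod (k x y) \<le> Re (k x y * cis ((y - x) \<bullet> (B *v \<theta>)))" for x y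
      using abs_Re_le_cmod[of "k x y * cis ((y - x) \<bullet> (B *v \<theta>))"] by (simp add: norm_mult)
  qed
  then show "\<exists>b. \<forall>\<theta>. b \<le> L \<theta>" by blast
  \<comment> \<open>Derivative of \<open>Re (k x y * cis s)\<close> in \<open>s\<close>, taken at
    \<open>s = (y - x) \<bullet> (B *v \<theta>)\<close>.\<close>
  define e where "e \<theta> x y = - (Re (k x y) * sin ((y - x) \<bullet> (B *v \<theta>)) + Im (k x y) * cos ((y - x) \<bullet> (B *v \<theta>)))" for \<theta> x y
  define d where "d \<theta> v = (\<Sum>x\<in>spin_configs. \<Sum>y\<in>spin_configs. e \<theta> x y * ((y - x) \<bullet> (B *v v)))" for \<theta> v
  have lin: "linear (d \<theta>)" for \<theta>
    by (rule linearI)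
      (simp_all add: d_def matrix_vector_right_distrib matrix_vector_mult_scaleR inner_add_right distrib_left
        sum.distrib sum_distrib_left mult_ac)
  have deriv: "((\<lambda>t. L (\<theta> + t *\<^sub>R v)) has_real_derivative d \<theta> v) (at 0)" for \<theta> v
    unfolding k d_def
  proof (intro DERIV_sum)
    fix x y
    show "((\<lambda>t. Re (k x y * cis ((y - x) \<bullet> (B *v (\<theta> + t *\<^sub>R v))))) has_real_derivative
        e \<theta> x y * ((y - x) \<bullet> (B *v v))) (at 0)"
      unfolding matrix_vector_right_distrib matrix_vector_mult_scaleR inner_add_right inner_scaleR_right
        times_complex.sel cis.sel e_def
      by (rule derivative_eq_intros refl | simp)+ (simp add: algebra_simps)
  qed
  show "((\<lambda>t. L (\<theta> + t *\<^sub>R v)) has_real_derivative grad L \<theta> \<bullet> v) (at 0)"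
    unfolding grad_eqI[OF deriv lin] by (rule deriv)
qed

theorem theorem3p4:
  fixes \<Sigma> :: "real^('n::{finite,linorder} \<times> 3)^('n \<times> 3)"
    and A :: "real^'p^('n \<times> 3)"
    and M :: nat and Z :: "nat \<Rightarrow> nat" and R :: "nat \<Rightarrow> real^3"
    and B :: "real^'p^('n::{finite,linorder})"
    and h :: "real^('n::{finite,linorder}) \<Rightarrow> real^('n::{finite,linorder}) \<Rightarrow> complex"
    and g :: "real^'p \<Rightarrow> real^'p" and S :: "real^'p \<Rightarrow> real^'p^'p"
    and lam mu C_g :: real and \<eta> :: "nat \<Rightarrow> real"
    and \<theta> :: "nat \<Rightarrow> real^'p" and \<Delta>\<theta> :: "int \<Rightarrow> real^'p"
  assumes cases:
    "(symmetric_pos_def \<Sigma> \<and> 0 < rank A \<and> rank A < CARD('p) \<and> inj_on R {1..M}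
        \<and> g = grad (energy lborel (electronic_hamiltonian M Z R) (gaussian_wf \<Sigma> A))
        \<and> S = SR_matrix lborel (gaussian_wf \<Sigma> A))
     \<or> (0 < rank B \<and> rank B < CARD('p) \<and> self_adjoint_spin_matrix h
        \<and> g = grad (energy (count_space spin_configs) (spin_hamiltonian h) (phase_wf B))
        \<and> S = SR_matrix (count_space spin_configs) (phase_wf B))"
    and lam: "lam > 0" and mu: "0 \<le> mu" "mu < 1"
    and C_g: "C_g > 0" "C_g-lipschitz_on UNIV g"
    and eta: "\<And>k. k \<ge> 1 \<Longrightarrow> 0 < \<eta> k \<and> \<eta> k \<le> \<eta> (k - 1)"
    and eta0: "0 < \<eta> 0" "\<eta> 0 \<le> 2 * lam * (1 - mu) / C_g"
    and update: "\<And>k. \<Delta>\<theta> (int k) =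
        matrix_inv (lam *\<^sub>R mat 1 + S (\<theta> k))
          *v ((lam * mu) *\<^sub>R \<Delta>\<theta> (int k - 1) - (1/2) *\<^sub>R g (\<theta> k))"
    and step: "\<And>k. \<theta> (Suc k) = \<theta> k + \<eta> k *\<^sub>R \<Delta>\<theta> (int k)"
  shows "\<exists>C>0. \<forall>K\<ge>1. (\<Sum>k=1..K. \<eta> k * (norm (g (\<theta> k)))\<^sup>2) \<le> C"
proof -
  obtain L b S0 where
    deriv: "\<And>x v. ((\<lambda>t. L (x + t *\<^sub>R v)) has_real_derivative g x \<bullet> v) (at 0)"
    and bound: "\<And>x. b \<le> L x"
    and S0: "\<And>x. S x = S0" and psd: "\<And>v. 0 \<le> v \<bullet> (S0 *v v)"
    using cases
  proof (elim disjE conjE)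
    assume \<Sigma>: "symmetric_pos_def \<Sigma>"
      and g: "g = grad (energy lborel (electronic_hamiltonian M Z R) (gaussian_wf \<Sigma> A))"
      and S: "S = SR_matrix lborel (gaussian_wf \<Sigma> A)"
    obtain m where m: "gaussian_weight (matrix_inv \<Sigma>) m"
      using symmetric_pos_def_inv[OF \<Sigma>] by blast
    interpret gaussian_weight "matrix_inv \<Sigma>" m by fact
    have wf: "gaussian_wf \<Sigma> A = (\<lambda>\<theta> x. complex_of_real (H (x - A *v \<theta>)))"
      by (simp add: gaussian_wf_def H_def fun_eq_iff)
    obtain S0 where S0: "\<And>x. S x = S0" "\<And>v. 0 \<le> v \<bullet> (S0 *v v)"
      unfolding S wf using SR_matrix_H by blast
    obtain b where b: "\<And>x. b \<le> energy lborel (electronic_hamiltonian M Z R) (gaussian_wf \<Sigma> A) x"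
      unfolding wf using energy_gaussian_regular(1)[OF m] by blast
    show thesis
    proof (rule that)
      show "((\<lambda>t. energy lborel (electronic_hamiltonian M Z R) (gaussian_wf \<Sigma> A) (x + t *\<^sub>R v))
          has_real_derivative g x \<bullet> v) (at 0)" for x v
        unfolding g wf by (rule energy_gaussian_regular(2)[OF m])
    qed (fact b S0)+
  next
    assume g: "g = grad (energy (count_space spin_configs) (spin_hamiltonian h) (phase_wf B))"
      and S: "S = SR_matrix (count_space spin_configs) (phase_wf B)"
    obtain S0 where S0: "\<And>x. S x = S0" "\<And>v. 0 \<le> v \<bullet> (S0 *v v)"
      unfolding S using SR_matrix_phase_wf by blast
    obtain b where b: "\<And>x. b \<le> energy (count_space spin_configs) (spin_hamiltonian h) (phase_wf B) x"
      using energy_phase_wf_regular(1) by blast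
    show thesis
    proof (rule that)
      show "((\<lambda>t. energy (count_space spin_configs) (spin_hamiltonian h) (phase_wf B) (x + t *\<^sub>R v))
          has_real_derivative g x \<bullet> v) (at 0)" for x v
        unfolding g by (rule energy_phase_wf_regular(2))
    qed (fact b S0)+
  qed
  show ?thesis
    by (rule momentum_gradient_sum_bound[OF deriv bound psd lam mu C_g eta eta0 update[unfolded S0] step])
qed

end
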